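(* Let $(\bar N,g)$ be an $n$-dimensional Riemannian manifold isometrically embedded in $\mathbb{R}^S$, $N\subset\bar N$ compact, and $1\le m\le n-1$. The following are equivalent: (i) $N$ contains no non-zero $m$-varifold with null weak mean curvature relative to $\bar N$; (ii) there exist an increasing $\Phi:[0,\infty)\to[0,\infty)$ with $\Phi(0)=0$ and $F:G_m(N)\times\mathbb{R}^S\to[0,\infty)$ satisfying condition (F) such that every $m$-varifold $V$ on $N$ with weak mean curvature $H^N$ relative to $\bar N$ satisfies $|V|\le\Phi\big(\int_{G_m(N)}F(x,P,H^N)\,dV\big)$; (iii) for every $F:G_m(N)\times\mathbb{R}^S\to[0,\infty)$ satisfying condition (F) there is $C_F>0$ such that every $m$-varifold $V$ on $N$ with weak mean curvature $H^N$ relative to $\bar N$ satisfies $|V|\le C_F\int_{G_m(N)}F(x,P,H^N)\,dV$.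
   Context: $G(S,m)$ is the Grassmannian of $m$-planes in $\mathbb{R}^S$, each $P$ identified with its orthogonal projection matrix $(P_{ij})$; $Q(x)=(Q_{ij}(x))$ is the orthogonal projection onto $T_x\bar N$; $G_m(N)=\{(x,P):x\in N,\ P\subset T_x\bar N\}$. An $m$-varifold on $N$ is any Radon measure $V$ on $G_m(N)$; $|V|=V(G_m(N))$. Weak mean curvature in $\mathbb{R}^S$: $\mathbb{R}^S$-valued $H\in L^1_{loc}(V)$ with $\int\operatorname{div}_PX\,dV=-\int H\cdot X\,dV$ for all $X\in C^1_c(\mathbb{R}^S;\mathbb{R}^S)$, $\operatorname{div}_PX=\sum_{i,j}P_{ij}\partial_jX^i$. $V$ on $N$ has weak mean curvature $H^N$ relative to $\bar N$ if as a varifold in $\mathbb{R}^S$ it has weak mean curvature $H^{\mathbb{R}^S}$; then $(H^N)_i=(H^{\mathbb{R}^S})_i-\sum_{j,k}P_{jk}\partial_{x_k}Q_{ij}(x)$. Condition (F) on $F:G_m(N)\times\mathbb{R}^\alpha\to\mathbb{R}$: continuous; $F\ge0$ with $F(x,P,q)=0$ iff $q=0$; convex in $q$; there is a continuous $\phi\ge0$, nondecreasing in $t$, $\phi(x,P,t)\to\infty$ locally uniformly as $t\to\infty$, with $\phi(x,P,|q|)|q|\le F(x,P,q)$. *)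

theory Defs
  imports "HOL-Analysis.Analysis"
begin

text \<open>C^k maps on an open set of a Euclidean space (real^'a), via iterated
  directional Frechet derivatives; smooth = C^k for every k.\<close>
fun Ck_on :: "nat \<Rightarrow> (real^'a \<Rightarrow> 'b::real_normed_vector) \<Rightarrow> (real^'a) set \<Rightarrow> bool" where
  "Ck_on 0 f U = continuous_on U f"
| "Ck_on (Suc k) f U =
     ((\<forall>x\<in>U. f differentiable (at x)) \<and>
      (\<forall>v. Ck_on k (\<lambda>x. frechet_derivative f (at x) v) U))"

definition smooth_on :: "(real^'a \<Rightarrow> 'b::real_normed_vector) \<Rightarrow> (real^'a) set \<Rightarrow> bool" where
  "smooth_on f U \<longleftrightarrow> (\<forall>k. Ck_on k f U)"

text \<open>n-dimensional smooth embedded submanifold of R^S (S = CARD('S)):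
  locally straightened by a diffeomorphism onto an n-dimensional linear subspace.\<close>
definition submanifold :: "nat \<Rightarrow> (real^'S) set \<Rightarrow> bool" where
  "submanifold n M \<longleftrightarrow>
     (\<forall>p\<in>M. \<exists>U W L (\<phi>::real^'S \<Rightarrow> real^'S) \<psi>.
        open U \<and> p \<in> U \<and> open W \<and> subspace L \<and> dim L = n \<and>
        smooth_on \<phi> U \<and> smooth_on \<psi> W \<and> \<phi> ` U = W \<and>
        (\<forall>x\<in>U. \<psi> (\<phi> x) = x) \<and> (\<forall>y\<in>W. \<phi> (\<psi> y) = y) \<and>
        \<phi> ` (M \<inter> U) = W \<inter> L)"

text \<open>Tangent space of M at x: velocities of curves in M through x.\<close>
definition tangent_space :: "(real^'S) set \<Rightarrow> real^'S \<Rightarrow> (real^'S) set" where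
  "tangent_space M x = {v. \<exists>\<gamma>. (\<forall>t\<in>{-1<..<1}. \<gamma> t \<in> M) \<and> \<gamma> 0 = x \<and>
                              (\<gamma> has_vector_derivative v) (at 0)}"

definition orth_proj :: "(real^'S) set \<Rightarrow> real^'S \<Rightarrow> real^'S" where
  "orth_proj L v = (THE y. y \<in> L \<and> (\<forall>z\<in>L. (v - y) \<bullet> z = 0))"

text \<open>Matrix of the orthogonal projection onto L.\<close>
definition proj_matrix :: "(real^'S) set \<Rightarrow> real^'S^'S" where
  "proj_matrix L = (\<chi> i j. orth_proj L (axis j 1) $ i)"

text \<open>Q(x): orthogonal projection onto T_x Nbar.\<close>
definition Qmap :: "(real^'S) set \<Rightarrow> real^'S \<Rightarrow> real^'S^'S" where
  "Qmap Nbar x = proj_matrix (tangent_space Nbar x)"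

text \<open>Grassmannian G(S,m) as orthogonal projection matrices of rank m.\<close>
definition Grass :: "nat \<Rightarrow> (real^'S^'S) set" where
  "Grass m = {P. transpose P = P \<and> P ** P = P \<and> rank P = m}"

definition Gm :: "(real^'S) set \<Rightarrow> nat \<Rightarrow> (real^'S) set \<Rightarrow> ((real^'S) \<times> (real^'S^'S)) set" where
  "Gm Nbar m N = {(x, P). x \<in> N \<and> P \<in> Grass m \<and> range ((*v) P) \<subseteq> tangent_space Nbar x}"

text \<open>m-varifold on N: Radon measure on G_m(N) (Borel, locally finite, concentrated on G_m(N)).\<close>
definition varifold :: "(real^'S) set \<Rightarrow> nat \<Rightarrow> (real^'S) set \<Rightarrow> ((real^'S) \<times> (real^'S^'S)) measure \<Rightarrow> bool" where
  "varifold Nbar m N V \<longleftrightarrow> sets V = sets borel \<and> (\<forall>K. compact K \<longrightarrow> emeasure V K < \<infinity>) \<and>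
     (AE z in V. z \<in> Gm Nbar m N)"

definition mass :: "((real^'S) \<times> (real^'S^'S)) measure \<Rightarrow> real" where
  "mass V = measure V (space V)"

text \<open>C^1 vector fields with compact support.\<close>
definition C1c :: "(real^'S \<Rightarrow> real^'S) \<Rightarrow> bool" where
  "C1c X \<longleftrightarrow> Ck_on 1 X UNIV \<and> compact (closure {x. X x \<noteq> 0})"

definition pderiv :: "(real^'S \<Rightarrow> real^'S) \<Rightarrow> 'S \<Rightarrow> 'S \<Rightarrow> real^'S \<Rightarrow> real" where
  "pderiv X j i x = frechet_derivative X (at x) (axis j 1) $ i"

definition divP :: "real^'S^'S \<Rightarrow> (real^'S \<Rightarrow> real^'S) \<Rightarrow> real^'S \<Rightarrow> real" where
  "divP P X x = (\<Sum>i\<in>UNIV. \<Sum>j\<in>UNIV. P $ i $ j * pderiv X j i x)"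

text \<open>H is a weak mean curvature of V in R^S.\<close>
definition weak_mc :: "((real^'S) \<times> (real^'S^'S)) measure \<Rightarrow> ((real^'S) \<times> (real^'S^'S) \<Rightarrow> real^'S) \<Rightarrow> bool" where
  "weak_mc V H \<longleftrightarrow> (\<forall>K. compact K \<longrightarrow> set_integrable V K H) \<and>
     (\<forall>X. C1c X \<longrightarrow>
        (\<integral>z. divP (snd z) X (fst z) \<partial>V) = - (\<integral>z. H z \<bullet> X (fst z) \<partial>V))"

text \<open>H^N_i = H_i - sum_{j,k} P_jk d_k Q_ij(x); the inner sum over k is the derivative of
  Q_ij in the (tangent) direction row_j(P), taken within Nbar.\<close>
definition HN :: "(real^'S) set \<Rightarrow> ((real^'S) \<times> (real^'S^'S) \<Rightarrow> real^'S) \<Rightarrow> (real^'S) \<times> (real^'S^'S) \<Rightarrow> real^'S" where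
  "HN Nbar H z = H z - (\<chi> i. \<Sum>j\<in>UNIV.
       frechet_derivative (Qmap Nbar) (at (fst z) within Nbar) (row j (snd z)) $ i $ j)"

text \<open>Condition (F), with alpha = S.\<close>
definition condF :: "((real^'S) \<times> (real^'S^'S)) set \<Rightarrow> ((real^'S) \<times> (real^'S^'S) \<Rightarrow> real^'S \<Rightarrow> real) \<Rightarrow> bool" where
  "condF G F \<longleftrightarrow>
     continuous_on (G \<times> UNIV) (\<lambda>(z, q). F z q) \<and>
     (\<forall>z\<in>G. \<forall>q. F z q \<ge> 0 \<and> (F z q = 0 \<longleftrightarrow> q = 0)) \<and>
     (\<forall>z\<in>G. convex_on UNIV (F z)) \<and>
     (\<exists>\<phi>. continuous_on (G \<times> {0..}) (\<lambda>(z, t). \<phi> z t) \<and>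
          (\<forall>z\<in>G. \<forall>t\<ge>0. \<phi> z t \<ge> 0) \<and>
          (\<forall>z\<in>G. mono_on {0..} (\<phi> z)) \<and>
          (\<forall>z0\<in>G. \<exists>U. open U \<and> z0 \<in> U \<and>
              (\<forall>M. \<exists>T. \<forall>t\<ge>T. \<forall>z\<in>U \<inter> G. \<phi> z t \<ge> M)) \<and>
          (\<forall>z\<in>G. \<forall>q. \<phi> z (norm q) * norm q \<le> F z q))"

end

theory Submission
  imports Defs "HOL-Probability.Probability"
begin

text \<open>
  The substantial implication is from (i) to (iii). If no constant works for \<open>F\<close>, there are varifolds
  \<open>V\<^sub>k\<close> of mass one (after rescaling) with \<open>\<integral> F(x, P, H\<^sup>N) dV\<^sub>k \<rightarrow> 0\<close>. Convexity of \<open>F\<close> in \<open>q\<close> and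
  compactness of \<open>G\<^sub>m(N)\<close> give, for every \<open>\<delta> > 0\<close>, some \<open>c > 0\<close> with \<open>c (|q| - \<delta>) \<le> F(x, P, q)\<close>, so that
  \<open>\<integral> |H\<^sup>N| dV\<^sub>k \<rightarrow> 0\<close>. A subsequence converges weakly to a probability measure on \<open>G\<^sub>m(N)\<close>, and since the
  curvature term \<open>\<Sum>\<^sub>j\<^sub>k P\<^sub>j\<^sub>k \<partial>\<^sub>k Q\<^sub>i\<^sub>j\<close> is continuous on \<open>G\<^sub>m(N)\<close>, the limit is a nonzero varifold with null
  mean curvature relative to the ambient manifold.

  Weak compactness on a compact set \<open>K\<close> is reduced to Helly's theorem on the line: a Borel injection
  \<open>h : K \<rightarrow> \<real>\<close> whose inverse is uniformly continuous (membership in a sequence of ever smaller balls,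
  read as ternary digits) transports measures to \<open>\<real>\<close>, and the continuous extension of \<open>h\<^sup>-\<^sup>1\<close> to the
  closure of \<open>h(K)\<close> transports the limit back.

  Continuity of the curvature term holds because in a chart \<open>\<phi>\<close> straightening the manifold to \<open>L\<close> the
  tangent space is the kernel of \<open>A = R D\<phi>\<close>, where \<open>R\<close> is the orthogonal projection onto the complement
  of \<open>L\<close>, and \<open>Q = 1 - A\<^sup>T (A A\<^sup>T + 1 - R)\<^sup>-\<^sup>1 A\<close> is a rational function of the entries of \<open>D\<phi>\<close>.
\<close>

section \<open>Weak compactness of probability measures on a compact set\<close>

text \<open>The term of index \<open>n\<close> has absolute value 3^-n, while all later terms
  together contribute at most 3^-n / 2. Base 3 leaves a gap after this cancellation, which base 2
  would not.\<close>

lemma ternary_series_separation: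
  fixes a :: "nat \<Rightarrow> real"
  assumes bound: "\<And>i. \<bar>a i\<bar> \<le> 1" and zero: "\<And>i. i < n \<Longrightarrow> a i = 0" and an: "\<bar>a n\<bar> = 1"
  shows "(1/3) ^ n / 2 \<le> \<bar>\<Sum>i. a i * (1/3) ^ i\<bar>"
proof -
  have sg: "summable (\<lambda>i. (1/3::real) ^ i)" by (simp add: summable_geometric)
  have s: "summable (\<lambda>i. a i * (1/3) ^ i)"
    by (rule summable_comparison_test'[OF sg]) (simp add: abs_mult bound mult_left_le_one_le)
  have "(\<Sum>i. a i * (1/3) ^ i) = (\<Sum>i. a (i + Suc n) * (1/3) ^ (i + Suc n)) + (\<Sum>i<Suc n. a i * (1/3) ^ i)"
    by (rule suminf_split_initial_segment[OF s])
  also have "(\<Sum>i<Suc n. a i * (1/3) ^ i) = a n * (1/3) ^ n" by (simp add: zero)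
  finally have eq: "(\<Sum>i. a i * (1/3) ^ i) = (\<Sum>i. a (i + Suc n) * (1/3) ^ (i + Suc n)) + a n * (1/3) ^ n" .
  have s1: "summable (\<lambda>i. (1/3::real) ^ (i + Suc n))"
    using sg by (subst summable_iff_shift)
  have "norm (a (i + Suc n) * (1/3) ^ (i + Suc n)) \<le> (1/3) ^ (i + Suc n)" for i
    unfolding norm_mult using bound[of "i + Suc n"]
    by (simp add: mult_left_le_one_le del: power_Suc)
  then have "norm (\<Sum>i. a (i + Suc n) * (1/3) ^ (i + Suc n)) \<le> (\<Sum>i. (1/3) ^ (i + Suc n))"
    by (intro norm_suminf_le s1)
  also have "(\<Sum>i. (1/3::real) ^ (i + Suc n)) = (\<Sum>i. (1/3) ^ Suc n * (1/3) ^ i)"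
    by (simp add: power_add mult_ac)
  also have "\<dots> = (1/3) ^ Suc n * (\<Sum>i. (1/3) ^ i)" by (rule suminf_mult[OF sg])
  also have "\<dots> = (1/3) ^ n / 2" by (simp add: suminf_geometric)
  finally have "\<bar>\<Sum>i. a (i + Suc n) * (1/3) ^ (i + Suc n)\<bar> \<le> (1/3) ^ n / 2" by simp
  moreover have "\<bar>a n * (1/3) ^ n\<bar> = (1/3) ^ n" by (simp add: abs_mult an)
  ultimately show ?thesis unfolding eq by linarith
qed

lemma compact_borel_code:
  fixes K :: "'a::euclidean_space set"
  assumes "compact K"
  obtains h :: "'a \<Rightarrow> real" where "h \<in> borel_measurable borel" "\<And>x. h x \<in> {0..2}"
    "\<And>e. e > 0 \<Longrightarrow> \<exists>d>0. \<forall>x\<in>K. \<forall>y\<in>K. \<bar>h x - h y\<bar> < d \<longrightarrow> dist x y < e"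
proof -
  have "\<exists>C. finite C \<and> C \<subseteq> K \<and> K \<subseteq> (\<Union>c\<in>C. ball c (1 / real (Suc k)))" for k
    using assms compactE_image[of K K "\<lambda>c. ball c (1 / real (Suc k))"]
    by (smt (verit) UN_iff centre_in_ball of_nat_0_less_iff open_ball subsetI zero_less_Suc zero_less_divide_1_iff)
  then obtain C where C: "\<And>k. finite (C k)" "\<And>k. K \<subseteq> (\<Union>c\<in>C k. ball c (1 / real (Suc k)))"
    by metis
  \<comment> \<open>The empty set keeps the family nonempty also when \<open>K\<close> is empty, so
    that \<open>from_nat_into\<close> enumerates exactly this family.\<close>
  define \<B> where "\<B> = insert {} (\<Union>k. (\<lambda>c. ball c (1 / real (Suc k))) ` C k)"
  have cB: "countable \<B>" "\<B> \<noteq> {}"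
    unfolding \<B>_def by (auto intro!: countable_UN countable_image intro: countable_finite[OF C(1)])
  define A where "A = from_nat_into \<B>"
  have rA: "range A = \<B>" unfolding A_def using cB by (simp add: range_from_nat_into)
  have oA: "open (A i)" for i
  proof -
    have "A i \<in> \<B>" using rA by auto
    then show ?thesis by (auto simp: \<B>_def)
  qed
  have mA[measurable]: "A i \<in> sets borel" for i using oA by auto
  define h where "h x = (\<Sum>i. indicator (A i) x * (1/3::real) ^ i)" for x
  have sg: "summable (\<lambda>i. (1/3::real) ^ i)" by (simp add: summable_geometric)
  have s: "summable (\<lambda>i. indicator (A i) x * (1/3::real) ^ i)" for x
    by (rule summable_comparison_test'[OF sg]) (simp add: indicator_def)
  have "h \<in> borel_measurable borel" unfolding h_def[abs_def] by measurable
  moreover have "h x \<in> {0..2}" for x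
  proof -
    have "h x \<le> (\<Sum>i. (1/3::real) ^ i)" unfolding h_def
      by (intro suminf_le s sg) (simp add: indicator_def)
    also have "\<dots> \<le> 2" by (simp add: suminf_geometric)
    finally show ?thesis unfolding h_def using suminf_nonneg[OF s] by simp
  qed
  moreover have "\<exists>d>0. \<forall>x\<in>K. \<forall>y\<in>K. \<bar>h x - h y\<bar> < d \<longrightarrow> dist x y < e" if "e > 0" for e
  proof -
    obtain k where k: "1 / real (Suc k) < e / 2" using \<open>e > 0\<close>
      using nat_approx_posE[of "e/2"] by (auto simp: field_simps)
    have "\<forall>c. \<exists>i. c \<in> C k \<longrightarrow> A i = ball c (1 / real (Suc k))"
    proof
      fix c
      show "\<exists>i. c \<in> C k \<longrightarrow> A i = ball c (1 / real (Suc k))"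
      proof (cases "c \<in> C k")
        case True
        then have "ball c (1 / real (Suc k)) \<in> range A" unfolding rA \<B>_def by blast
        then show ?thesis by (metis rangeE)
      qed auto
    qed
    then obtain i where i: "\<And>c. c \<in> C k \<Longrightarrow> A (i c) = ball c (1 / real (Suc k))" by metis
    \<comment> \<open>All balls of the k-th cover occur among the first \<open>M\<close> digits, so
      agreement on these digits decides membership in each of them.\<close>
    obtain M where M: "\<And>c. c \<in> C k \<Longrightarrow> i c < M"
      using C(1)[of k] finite_nat_set_iff_bounded[of "i ` C k"] by auto
    show ?thesis
    proof (intro exI conjI ballI impI)
      show "(1/3::real) ^ M / 2 > 0" by simp
      fix x y assume xy: "x \<in> K" "y \<in> K" and d: "\<bar>h x - h y\<bar> < (1/3) ^ M / 2"
      have agree: "x \<in> A j \<longleftrightarrow> y \<in> A j" if "j < M" for j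
      proof (rule ccontr)
        assume ne: "\<not> (x \<in> A j \<longleftrightarrow> y \<in> A j)"
        \<comment> \<open>The first digit in which the two codes differ: there the digit difference
          is 1 in absolute value and all earlier ones vanish, as the separation estimate
          asks.\<close>
        define n where "n = (LEAST j. \<not> (x \<in> A j \<longleftrightarrow> y \<in> A j))"
        have n: "\<not> (x \<in> A n \<longleftrightarrow> y \<in> A n)" unfolding n_def by (rule LeastI) (rule ne)
        have less: "x \<in> A i \<longleftrightarrow> y \<in> A i" if "i < n" for i
          using that not_less_Least unfolding n_def by blast
        have "n \<le> j" unfolding n_def by (rule Least_le) (rule ne)
        have "(1/3) ^ n / 2 \<le> \<bar>\<Sum>i. (indicator (A i) x - indicator (A i) y) * (1/3::real) ^ i\<bar>"
          by (rule ternary_series_separation) (use n less in \<open>auto simp: indicator_def\<close>)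
        also have "(\<Sum>i. (indicator (A i) x - indicator (A i) y) * (1/3::real) ^ i) = h x - h y"
          unfolding h_def by (simp add: left_diff_distrib suminf_diff[OF s s])
        finally have "(1/3::real) ^ n / 2 < (1/3) ^ M / 2" using d by linarith
        moreover have "(1/3::real) ^ M \<le> (1/3) ^ n"
          using \<open>n \<le> j\<close> \<open>j < M\<close> by (intro power_decreasing) auto
        ultimately show False by linarith
      qed
      obtain c where c: "c \<in> C k" "x \<in> ball c (1 / real (Suc k))" using C(2)[of k] xy by blast
      with agree[OF M[OF c(1)]] i[OF c(1)] have "y \<in> ball c (1 / real (Suc k))" by auto
      with c k show "dist x y < e" using dist_triangle[of x y c]
        by (auto simp: dist_commute)
    qed
  qed
  ultimately show thesis by (rule that)
qed

text \<open>The code \<open>h\<close> pushes the measures to the line, where tightness yields a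
  weakly convergent subsequence. As \<open>h\<close> itself need not be continuous, a test function
  \<open>f\<close> on \<open>K\<close> is read on the line as \<open>f \<circ> g\<close>, where
  \<open>g\<close> extends the inverse of \<open>h\<close> continuously to the closure of the image;
  the limit is pushed back by \<open>g\<close>.\<close>

lemma compact_prob_measures_subseq:
  fixes K :: "'a::euclidean_space set" and \<mu> :: "nat \<Rightarrow> 'a measure"
  assumes K: "compact K" and prob: "\<And>n. prob_space (\<mu> n)"
    and sets: "\<And>n. sets (\<mu> n) = sets borel" and AEK: "\<And>n. AE z in \<mu> n. z \<in> K"
  obtains r \<nu> where "strict_mono (r :: nat \<Rightarrow> nat)" "prob_space \<nu>" "sets \<nu> = sets borel"
    "AE z in \<nu>. z \<in> K"
    "\<And>f::'a \<Rightarrow> real. continuous_on K f \<Longrightarrow>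
       (\<lambda>n. \<integral>z. indicator K z *\<^sub>R f z \<partial>\<mu> (r n)) \<longlonglongrightarrow> (\<integral>z. indicator K z *\<^sub>R f z \<partial>\<nu>)"
proof -
  obtain h :: "'a \<Rightarrow> real" where h[measurable]: "h \<in> borel_measurable borel" and h01: "\<And>x. h x \<in> {0..2}"
    and sep: "\<And>e. e > 0 \<Longrightarrow> \<exists>d>0. \<forall>x\<in>K. \<forall>y\<in>K. \<bar>h x - h y\<bar> < d \<longrightarrow> dist x y < e"
    using compact_borel_code[OF K] by blast
  note [measurable_cong] = sets
  have Kb[measurable]: "K \<in> sets borel" using K by (simp add: borel_compact)
  have "K \<noteq> {}"
  proof
    assume "K = {}"
    then have "AE z in \<mu> 0. False" using AEK[of 0] by simp
    then show False using prob_space.AE_False[OF prob[of 0]] by simp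
  qed
  then obtain z0 where z0: "z0 \<in> K" by blast
  have inj: "inj_on h K"
  proof (rule inj_onI)
    fix x y assume "x \<in> K" "y \<in> K" "h x = h y"
    then have "dist x y < e" if "e > 0" for e using sep[OF that] by auto
    then have "\<not> dist x y > 0" by blast
    then show "x = y" by simp
  qed
  define C where "C = closure (h ` K)"
  have bd: "bounded (h ` K)"
    by (rule bounded_subset[of "{0..2}"]) (use h01 in auto)
  have C: "compact C" "closed C" unfolding C_def using bd by (auto simp: compact_closure)
  have Cb[measurable]: "C \<in> sets borel" using C by auto
  \<comment> \<open>The separation property of the code is precisely uniform continuity of its
    inverse, which is what permits the extension to the closure.\<close>
  have "uniformly_continuous_on (h ` K) (inv_into K h)"
    unfolding uniformly_continuous_on_def using sep inj
    by (simp add: dist_real_def inv_into_f_f) (metis abs_minus_commute dist_commute)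
  then obtain g where g: "uniformly_continuous_on C g" and geq: "\<And>x. x \<in> h ` K \<Longrightarrow> inv_into K h x = g x"
    unfolding C_def by (rule uniformly_continuous_on_extension_on_closure) blast
  have gc: "continuous_on C g" using g by (rule uniformly_continuous_imp_continuous)
  have gh: "g (h z) = z" if "z \<in> K" for z using geq[of "h z"] that inj by auto
  have gK: "g x \<in> K" if "x \<in> C" for x
  proof -
    have "g ` closure (h ` K) \<subseteq> K"
      by (rule image_closure_subset) (use gc C_def gh K in \<open>auto intro: compact_imp_closed\<close>)
    then show ?thesis using that unfolding C_def by blast
  qed
  define \<rho> where "\<rho> n = distr (\<mu> n) borel h" for n
  have mh: "h \<in> measurable (\<mu> n) borel" for n by measurable
  have rd: "real_distribution (\<rho> n)" for n
    unfolding real_distribution_def real_distribution_axioms_def \<rho>_def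
    using prob_space.prob_space_distr[OF prob mh] by auto
  \<comment> \<open>Tightness is tested on intervals open at the left, so the endpoint -1 is taken
    strictly below the range of \<open>h\<close>.\<close>
  have "measure (\<rho> n) {-1<..2} = 1" for n
  proof -
    have "measure (\<rho> n) {-1<..2} = measure (\<mu> n) (h -` {-1<..2} \<inter> space (\<mu> n))"
      unfolding \<rho>_def by (rule measure_distr) (use mh in auto)
    also have "h -` {-1<..2} \<inter> space (\<mu> n) = space (\<mu> n)"
      using h01 by (auto simp: order_less_le_trans[of "-1::real" 0])
    finally show ?thesis using prob_space.prob_space[OF prob] by simp
  qed
  then have "tight \<rho>" unfolding tight_def using rd
    by (intro conjI allI impI exI[of _ "-1::real"] exI[of _ "2::real"]) simp_all
  from tight_imp_convergent_subsubsequence[OF this strict_mono_id]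
  obtain r M where r: "strict_mono (r :: nat \<Rightarrow> nat)" and M: "real_distribution M"
    and conv: "weak_conv_m (\<rho> \<circ> id \<circ> r) M" by blast
  interpret M: real_distribution M by fact
  have conv2: "(\<lambda>n. \<integral>z. F (h z) \<partial>\<mu> (r n)) \<longlonglongrightarrow> (\<integral>x. F x \<partial>M)"
    if F: "continuous_on UNIV F" and B: "\<And>x. norm (F x) \<le> B" for F :: "real \<Rightarrow> real" and B
  proof -
    have [measurable]: "F \<in> borel_measurable borel" using F by (rule borel_measurable_continuous_onI)
    have "(\<lambda>n. integral\<^sup>L ((\<rho> \<circ> id \<circ> r) n) F) \<longlonglongrightarrow> integral\<^sup>L M F"
    proof (rule weak_conv_imp_integral_bdd_continuous_conv[OF _ M conv])
      show "real_distribution ((\<rho> \<circ> id \<circ> r) n)" for n using rd by simp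
      show "isCont F x" for x using F by (simp add: continuous_on_eq_continuous_at)
      show "norm (F x) \<le> B" for x by (rule B)
    qed
    moreover have "integral\<^sup>L ((\<rho> \<circ> id \<circ> r) n) F = (\<integral>z. F (h z) \<partial>\<mu> (r n))" for n
      unfolding \<rho>_def comp_def by (simp add: integral_distr[OF mh])
    ultimately show ?thesis by simp
  qed
  have hC: "h z \<in> C" if "z \<in> K" for z unfolding C_def using that by (intro subsetD[OF closure_subset] imageI)
  have Cne: "C \<noteq> {}" using hC z0 by auto
  have AEC: "AE x in M. x \<in> C"
  proof -
    \<comment> \<open>This bounded continuous function vanishes exactly on the closed set
      \<open>C\<close>. Its integrals before the limit are all 0, hence so is the limit integral,
      and the limit measure lives on \<open>C\<close>.\<close>
    define F where "F x = min 1 (infdist x C)" for x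
    have Fc: "continuous_on UNIV F" unfolding F_def by (intro continuous_intros)
    have [measurable]: "F \<in> borel_measurable borel" using Fc by (rule borel_measurable_continuous_onI)
    have F0: "0 \<le> F x" "F x \<le> 1" for x unfolding F_def by (auto simp: infdist_nonneg)
    have "(\<integral>z. F (h z) \<partial>\<mu> (r n)) = 0" for n
    proof -
      have "(\<integral>z. F (h z) \<partial>\<mu> (r n)) = (\<integral>z. 0 \<partial>\<mu> (r n))"
      proof (rule integral_cong_AE)
        show "AE z in \<mu> (r n). F (h z) = 0" using AEK[of "r n"]
          by eventually_elim (use hC in \<open>auto simp: F_def\<close>)
      qed measurable
      then show ?thesis by simp
    qed
    with conv2[OF Fc, of 1] F0 have "(\<integral>x. F x \<partial>M) = 0"
      by (simp add: LIMSEQ_const_iff)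
    moreover have "integrable M F"
      by (rule M.integrable_const_bound[where B=1]) (use F0 in auto)
    ultimately have "AE x in M. F x = 0"
      using integral_nonneg_eq_0_iff_AE[of M F] F0 by simp
    then show ?thesis
    proof eventually_elim
      case (elim x)
      then have "infdist x C = 0" unfolding F_def by (auto simp: min_def split: if_splits)
      then show ?case using C(2) Cne in_closed_iff_infdist_zero by blast
    qed
  qed
  \<comment> \<open>The value \<open>z0\<close> off \<open>C\<close> is a default on a null set; it
    makes \<open>g'\<close> a Borel map with all its values in \<open>K\<close>.\<close>
  define g' where "g' x = (if x \<in> C then g x else z0)" for x
  have g'm[measurable]: "g' \<in> borel_measurable borel"
    unfolding g'_def[abs_def] by (intro borel_measurable_continuous_on_if Cb gc continuous_on_const)
  have g'm2: "g' \<in> measurable M borel" by (simp add: measurable_cong_sets[OF M.events_eq_borel refl])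
  define \<nu> where "\<nu> = distr M borel g'"
  show thesis
  proof (rule that[OF r, of \<nu>])
    show "prob_space \<nu>" unfolding \<nu>_def by (rule M.prob_space_distr[OF g'm2])
    show "sets \<nu> = sets borel" unfolding \<nu>_def by simp
    have g'K: "g' x \<in> K" for x unfolding g'_def using gK z0 by auto
    show "AE z in \<nu>. z \<in> K" unfolding \<nu>_def by (subst AE_distr_iff[OF g'm2]) (auto simp: g'K)
    fix f :: "'a \<Rightarrow> real" assume f: "continuous_on K f"
    define f' where "f' z = indicator K z *\<^sub>R f z" for z
    have [measurable]: "f' \<in> borel_measurable borel" unfolding f'_def[abs_def]
      by (rule borel_measurable_continuous_on_indicator[OF Kb f])
    have fg: "continuous_on C (f \<circ> g)"
      by (intro continuous_on_compose gc continuous_on_subset[OF f]) (use gK in auto)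
    then have "bounded ((f \<circ> g) ` C)" using C(1) by (intro compact_imp_bounded compact_continuous_image)
    then obtain B where B: "B > 0" "\<And>x. x \<in> C \<Longrightarrow> norm ((f \<circ> g) x) \<le> B"
      unfolding bounded_pos by auto
    \<comment> \<open>Weak convergence on the line needs a bounded continuous function on all of it,
      whereas \<open>f \<circ> g\<close> is continuous on \<open>C\<close> only; Tietze's theorem
      extends it with the same bound.\<close>
    obtain F where F: "continuous_on UNIV F" "\<And>x. x \<in> C \<Longrightarrow> F x = (f \<circ> g) x" "\<And>x. x \<in> UNIV \<Longrightarrow> norm (F x) \<le> B"
      by (rule Tietze[OF fg, of UNIV B]) (use C B in auto)
    have [measurable]: "F \<in> borel_measurable borel" using F(1) by (rule borel_measurable_continuous_onI)
    have "(\<integral>z. F (h z) \<partial>\<mu> (r n)) = (\<integral>z. f' z \<partial>\<mu> (r n))" for n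
    proof (rule integral_cong_AE)
      show "AE z in \<mu> (r n). F (h z) = f' z" using AEK[of "r n"]
        by eventually_elim (use hC gh F in \<open>auto simp: f'_def\<close>)
    qed measurable
    moreover have "(\<integral>x. F x \<partial>M) = (\<integral>z. f' z \<partial>\<nu>)"
    proof -
      have "(\<integral>z. f' z \<partial>\<nu>) = (\<integral>x. f' (g' x) \<partial>M)" unfolding \<nu>_def
        by (rule integral_distr[OF g'm2]) measurable
      also have "\<dots> = (\<integral>x. F x \<partial>M)"
      proof (rule integral_cong_AE)
        show "AE x in M. f' (g' x) = F x" using AEC
          by eventually_elim (use gK F in \<open>auto simp: f'_def g'_def\<close>)
      qed measurable
      finally show ?thesis by simp
    qed
    ultimately show "(\<lambda>n. \<integral>z. indicator K z *\<^sub>R f z \<partial>\<mu> (r n)) \<longlonglongrightarrow> (\<integral>z. indicator K z *\<^sub>R f z \<partial>\<nu>)"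
      using conv2[OF F(1), of B] F(3) unfolding f'_def by simp
  qed
qed

section \<open>Projections onto tangent spaces\<close>

text \<open>Derivatives found by the product or quotient rule can serve as witnesses, since
  uniqueness identifies them with \<open>frechet_derivative\<close>.\<close>

lemma Ck_on_1_iff:
  "Ck_on 1 f U \<longleftrightarrow>
     (\<exists>f'. (\<forall>x\<in>U. (f has_derivative f' x) (at x)) \<and> (\<forall>v. continuous_on U (\<lambda>x. f' x v)))"
proof
  assume "Ck_on 1 f U"
  then show "\<exists>f'. (\<forall>x\<in>U. (f has_derivative f' x) (at x)) \<and> (\<forall>v. continuous_on U (\<lambda>x. f' x v))"
    by (intro exI[of _ "\<lambda>x. frechet_derivative f (at x)"])
      (auto simp: frechet_derivative_works)
next
  assume "\<exists>f'. (\<forall>x\<in>U. (f has_derivative f' x) (at x)) \<and> (\<forall>v. continuous_on U (\<lambda>x. f' x v))"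
  then obtain f' where f': "\<And>x. x \<in> U \<Longrightarrow> (f has_derivative f' x) (at x)"
    "\<And>v. continuous_on U (\<lambda>x. f' x v)" by blast
  have "continuous_on U (\<lambda>x. frechet_derivative f (at x) v)" for v
    using f'(2)[of v] by (rule continuous_on_eq) (use frechet_derivative_at[OF f'(1)] in simp)
  then show "Ck_on 1 f U" using f'(1) by (auto simp: differentiable_def)
qed

lemma Ck_on_1_imp_continuous_on:
  assumes "Ck_on 1 f U" shows "continuous_on U f"
  using assms by (auto intro!: differentiable_imp_continuous_on
      simp: differentiable_on_def differentiable_at_withinI)

lemma Ck_on_1_const: "Ck_on 1 (\<lambda>x. c) U"
  unfolding Ck_on_1_iff by (intro exI[of _ "\<lambda>x v. 0"]) auto

lemma Ck_on_1_add:
  assumes "Ck_on 1 f U" "Ck_on 1 g U"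
  shows "Ck_on 1 (\<lambda>x. f x + g x) U"
proof -
  obtain f' g' where "\<forall>x\<in>U. (f has_derivative f' x) (at x)" "\<forall>v. continuous_on U (\<lambda>x. f' x v)"
    "\<forall>x\<in>U. (g has_derivative g' x) (at x)" "\<forall>v. continuous_on U (\<lambda>x. g' x v)"
    using assms unfolding Ck_on_1_iff by blast
  then show ?thesis unfolding Ck_on_1_iff
    by (intro exI[of _ "\<lambda>x v. f' x v + g' x v"])
      (auto intro!: derivative_intros continuous_intros)
qed

lemma Ck_on_1_mult:
  fixes f g :: "real^'a \<Rightarrow> real"
  assumes "Ck_on 1 f U" "Ck_on 1 g U"
  shows "Ck_on 1 (\<lambda>x. f x * g x) U"
proof -
  obtain f' g' where "\<forall>x\<in>U. (f has_derivative f' x) (at x)" "\<forall>v. continuous_on U (\<lambda>x. f' x v)"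
    "\<forall>x\<in>U. (g has_derivative g' x) (at x)" "\<forall>v. continuous_on U (\<lambda>x. g' x v)"
    using assms unfolding Ck_on_1_iff by blast
  then show ?thesis unfolding Ck_on_1_iff
    using Ck_on_1_imp_continuous_on[OF assms(1)] Ck_on_1_imp_continuous_on[OF assms(2)]
    by (intro exI[of _ "\<lambda>x v. f x * g' x v + f' x v * g x"])
      (auto intro!: has_derivative_mult continuous_intros)
qed

lemma Ck_on_1_divide:
  fixes f g :: "real^'a \<Rightarrow> real"
  assumes "Ck_on 1 f U" "Ck_on 1 g U" and nz: "\<And>x. x \<in> U \<Longrightarrow> g x \<noteq> 0"
  shows "Ck_on 1 (\<lambda>x. f x / g x) U"
proof -
  obtain f' g' where "\<forall>x\<in>U. (f has_derivative f' x) (at x)" "\<forall>v. continuous_on U (\<lambda>x. f' x v)"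
    "\<forall>x\<in>U. (g has_derivative g' x) (at x)" "\<forall>v. continuous_on U (\<lambda>x. g' x v)"
    using assms unfolding Ck_on_1_iff by blast
  then show ?thesis unfolding Ck_on_1_iff
    using Ck_on_1_imp_continuous_on[OF assms(1)] Ck_on_1_imp_continuous_on[OF assms(2)] nz
    by (intro exI[of _ "\<lambda>x v. (f' x v * g x - f x * g' x v) / (g x * g x)"])
      (auto intro!: has_derivative_divide' continuous_intros)
qed

lemma Ck_on_1_sum:
  assumes "finite I" "\<And>i. i \<in> I \<Longrightarrow> Ck_on 1 (f i) U"
  shows "Ck_on 1 (\<lambda>x. \<Sum>i\<in>I. f i x) U"
  using assms
proof (induction I rule: finite_induct)
  case empty
  then show ?case using Ck_on_1_const[of 0] by simp
next
  case (insert a I)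
  then show ?case using Ck_on_1_add[of "f a" U "\<lambda>x. \<Sum>i\<in>I. f i x"] by simp
qed

lemma Ck_on_1_prod:
  fixes f :: "'i \<Rightarrow> real^'a \<Rightarrow> real"
  assumes "finite I" "\<And>i. i \<in> I \<Longrightarrow> Ck_on 1 (f i) U"
  shows "Ck_on 1 (\<lambda>x. \<Prod>i\<in>I. f i x) U"
  using assms
proof (induction I rule: finite_induct)
  case empty
  then show ?case using Ck_on_1_const[of 1] by simp
next
  case (insert a I)
  then show ?case using Ck_on_1_mult[of "f a" U "\<lambda>x. \<Prod>i\<in>I. f i x"] by simp
qed

text \<open>The determinant is a polynomial in the entries. Together with Cramer's rule this avoids
  differentiating a matrix inverse.\<close>

lemma Ck_on_1_det:
  fixes A :: "real^'a \<Rightarrow> real^'n^'n"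
  assumes "\<And>i j. Ck_on 1 (\<lambda>x. A x $ i $ j) U"
  shows "Ck_on 1 (\<lambda>x. det (A x)) U"
  unfolding det_def
  by (intro Ck_on_1_sum Ck_on_1_mult Ck_on_1_prod Ck_on_1_const assms) auto

lemma Ck_on_1_nth:
  assumes "Ck_on 1 f U"
  shows "Ck_on 1 (\<lambda>x. f x $ i) U"
proof -
  obtain f' where "\<forall>x\<in>U. (f has_derivative f' x) (at x)" "\<forall>v. continuous_on U (\<lambda>x. f' x v)"
    using assms unfolding Ck_on_1_iff by blast
  then show ?thesis unfolding Ck_on_1_iff
    by (intro exI[of _ "\<lambda>x v. f' x v $ i"])
      (auto intro!: bounded_linear.has_derivative[OF bounded_linear_vec_nth] continuous_intros)
qed

lemma has_derivative_vec_lambda: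
  fixes f :: "'n::finite \<Rightarrow> 'a::real_normed_vector \<Rightarrow> 'b::euclidean_space"
  assumes "\<And>i. (f i has_derivative f' i) (at a within S)"
  shows "((\<lambda>x. \<chi> i. f i x) has_derivative (\<lambda>v. \<chi> i. f' i v)) (at a within S)"
  unfolding has_derivative_componentwise_within[of "\<lambda>x. \<chi> i. f i x"]
  by (auto simp: Basis_vec_def inner_axis intro!: has_derivative_inner_left assms)

lemma Ck_on_1_vec_lambda:
  fixes f :: "'n::finite \<Rightarrow> real^'a \<Rightarrow> 'b::euclidean_space"
  assumes "\<And>i. Ck_on 1 (f i) U"
  shows "Ck_on 1 (\<lambda>x. \<chi> i. f i x) U"
proof -
  have "\<forall>i. \<exists>f'. (\<forall>x\<in>U. (f i has_derivative f' x) (at x)) \<and> (\<forall>v. continuous_on U (\<lambda>x. f' x v))"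
    using assms unfolding Ck_on_1_iff by blast
  then obtain f' where "\<And>i x. x\<in>U \<Longrightarrow> (f i has_derivative f' i x) (at x)"
     "\<And>i v. continuous_on U (\<lambda>x. f' i x v)"
    by metis
  then show ?thesis unfolding Ck_on_1_iff
    by (intro exI[of _ "\<lambda>x v. \<chi> i. f' i x v"])
      (auto intro!: has_derivative_vec_lambda continuous_intros)
qed

section \<open>Orthogonal projections and tangent spaces in charts\<close>

text \<open>The matrix is the sum of b b^T over an orthonormal basis of the orthogonal complement of
  \<open>L\<close>; its kernel is the double complement, which is \<open>L\<close> again.\<close>

lemma orthogonal_complement_matrix:
  fixes L :: "(real^'n) set"
  assumes "subspace L"
  obtains R :: "real^'n^'n" where "transpose R = R" "R ** R = R" "\<And>w. R *v w = 0 \<longleftrightarrow> w \<in> L"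
proof -
  obtain B where B: "B \<subseteq> L\<^sup>\<bottom>" "pairwise orthogonal B" "\<And>x. x \<in> B \<Longrightarrow> norm x = 1"
    "independent B" "card B = dim (L\<^sup>\<bottom>)" "span B = L\<^sup>\<bottom>"
    by (rule orthonormal_basis_subspace[OF subspace_orthogonal_comp]) blast
  have fin: "finite B" using B(4) by (rule independent_imp_finite)
  define R :: "real^'n^'n" where "R = (\<chi> i j. \<Sum>b\<in>B. b $ i * b $ j)"
  have Rv: "R *v w = (\<Sum>b\<in>B. (b \<bullet> w) *\<^sub>R b)" for w
    by (simp add: R_def matrix_vector_mult_def vec_eq_iff inner_vec_def sum_distrib_left sum_distrib_right
        sum.swap[of _ B] mult_ac)
  have inner: "b \<bullet> (R *v w) = b \<bullet> w" if "b \<in> B" for b w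
  proof -
    have "b \<bullet> (R *v w) = (\<Sum>c\<in>B. (c \<bullet> w) * (b \<bullet> c))" by (simp add: Rv inner_sum_right)
    also have "\<dots> = (\<Sum>c\<in>B. if c = b then c \<bullet> w else 0)"
    proof (rule sum.cong[OF refl])
      fix c assume "c \<in> B"
      then show "(c \<bullet> w) * (b \<bullet> c) = (if c = b then c \<bullet> w else 0)"
        using B(2) B(3)[of b] that by (auto simp: pairwise_def orthogonal_def norm_eq_1)
    qed
    also have "\<dots> = b \<bullet> w" using fin that by simp
    finally show ?thesis .
  qed
  show thesis
  proof
    show "transpose R = R" by (simp add: R_def transpose_def vec_eq_iff mult.commute)
    have "R *v (R *v w) = R *v w" for w
      by (subst (1 3) Rv) (simp add: inner)
    then show "R ** R = R" by (simp add: matrix_eq flip: matrix_vector_mul_assoc)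
    show "R *v w = 0 \<longleftrightarrow> w \<in> L" for w
    proof
      assume "R *v w = 0"
      then have "b \<bullet> w = 0" if "b \<in> B" for b using inner[OF that, of w] by simp
      then have "orthogonal w b" if "b \<in> span B" for b
        using that orthogonal_to_span[of b B w] by (auto simp: orthogonal_def inner_commute)
      then have "w \<in> L\<^sup>\<bottom>\<^sup>\<bottom>" unfolding B(6) by (auto simp: orthogonal_comp_def orthogonal_commute)
      then show "w \<in> L" using orthogonal_comp_self[OF assms] by simp
    next
      assume "w \<in> L"
      then have "b \<bullet> w = 0" if "b \<in> B" for b
        using B(1) that by (auto simp: orthogonal_comp_def orthogonal_def inner_commute)
      then show "R *v w = 0" by (simp add: Rv)
    qed
  qed
qed

lemma orth_proj_unique:
  assumes "subspace L" "y \<in> L" "\<And>z. z \<in> L \<Longrightarrow> (v - y) \<bullet> z = 0"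
  shows "orth_proj L v = y"
  unfolding orth_proj_def
proof (rule the_equality)
  show "y \<in> L \<and> (\<forall>z\<in>L. (v - y) \<bullet> z = 0)" using assms by blast
  fix y' assume y': "y' \<in> L \<and> (\<forall>z\<in>L. (v - y') \<bullet> z = 0)"
  have "y' - y \<in> L" using assms y' by (simp add: subspace_diff)
  then have "(v - y) \<bullet> (y' - y) = 0" "(v - y') \<bullet> (y' - y) = 0" using assms y' by auto
  then have "(y' - y) \<bullet> (y' - y) = 0" by (simp add: inner_diff_left)
  then show "y' = y" by simp
qed

text \<open>On the range of \<open>R\<close> the matrix N N^T is injective because N^T is, and
  adding 1 - R makes \<open>G\<close> invertible on the whole space. The solution \<open>u\<close>
  of G u = N v lies in the range of \<open>R\<close>, so N N^T u = N v: thus v - N^T u is in the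
  kernel of \<open>N\<close>, and N^T u is orthogonal to that kernel. Cramer's rule for
  \<open>u\<close> displays the projection as a rational function of the entries of \<open>N\<close>
  and \<open>R\<close>.\<close>

lemma orth_proj_kernel_matrix:
  fixes N R :: "real^'n^'n"
  assumes R: "transpose R = R" "R ** R = R" and RN: "R ** N = N"
    and inj: "\<And>u. R *v u = u \<Longrightarrow> transpose N *v u = 0 \<Longrightarrow> u = 0"
  defines "G \<equiv> N ** transpose N + (mat 1 - R)"
  shows "det G \<noteq> 0"
    and "proj_matrix {v. N *v v = 0} =
      (\<chi> i j. (if i = j then 1 else 0) -
        (\<Sum>k\<in>UNIV. N $ k $ i * (det (\<chi> a b. if b = k then N $ a $ j else G $ a $ b) / det G)))"
proof -
  have Gv: "G *v u = N *v (transpose N *v u) + u - R *v u" for u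
    by (simp add: G_def matrix_vector_mult_add_rdistrib matrix_vector_mult_diff_rdistrib
        matrix_vector_mul_assoc del: transpose_matrix_vector)
  have RNv: "R *v (N *v u) = N *v u" for u by (simp add: matrix_vector_mul_assoc RN)
  have RRv: "R *v (R *v u) = R *v u" for u by (simp add: matrix_vector_mul_assoc R)
  \<comment> \<open>In the equation \<open>e\<close> the left side is killed by \<open>R\<close> and
    the right side is fixed by it, so both vanish.\<close>
  have Ru: "R *v u = u" if "G *v u = N *v v" for u v
  proof -
    have "N *v v - (N *v (transpose N *v u) + u - R *v u) = 0" using that Gv by simp
    then have e: "u - R *v u = N *v v - N *v (transpose N *v u)" by (simp add: algebra_simps)
    then have "R *v (u - R *v u) = R *v (N *v v - N *v (transpose N *v u))" by simp
    then have "N *v v - N *v (transpose N *v u) = 0"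
      by (simp add: matrix_vector_mult_diff_distrib RRv RNv)
    with e show ?thesis by simp
  qed
  have "u = 0" if "G *v u = 0" for u
  proof -
    have R: "R *v u = u" using Ru[of u 0] that by simp
    then have "N *v (transpose N *v u) = 0" using that Gv[of u] by simp
    then have "(transpose N *v u) \<bullet> (transpose N *v u) = 0"
      by (metis dot_lmul_matrix inner_zero_right transpose_matrix_vector)
    then show ?thesis using inj[OF R] by simp
  qed
  then have "invertible G" using matrix_left_invertible_ker invertible_left_inverse by blast
  then show dG: "det G \<noteq> 0" by (simp add: invertible_det_nz)
  have sub: "subspace {v. N *v v = 0}"
    by (auto simp: subspace_def matrix_vector_right_distrib matrix_vector_mult_scaleR)
  have "orth_proj {v. N *v v = 0} v =
     v - transpose N *v (\<chi> k. det (\<chi> a b. if b = k then (N *v v) $ a else G $ a $ b) / det G)" for v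
  proof -
    define u where "u = (\<chi> k. det (\<chi> a b. if b = k then (N *v v) $ a else G $ a $ b) / det G)"
    have Gu: "G *v u = N *v v" using cramer[OF dG, of u "N *v v"] unfolding u_def by simp
    have "N *v (transpose N *v u) = N *v v" using Gv[of u] Gu Ru[OF Gu] by simp
    then have "N *v (v - transpose N *v u) = 0" by (simp add: matrix_vector_mult_diff_distrib)
    moreover have "(v - (v - transpose N *v u)) \<bullet> z = 0" if "N *v z = 0" for z
      using that by (simp add: dot_lmul_matrix)
    ultimately show ?thesis unfolding u_def[symmetric] by (intro orth_proj_unique sub) auto
  qed
  moreover have "(N *v axis j 1) $ a = N $ a $ j" for a j
    by (simp add: matrix_vector_mult_basis column_def)
  moreover have "(transpose N *v c) $ i = (\<Sum>k\<in>UNIV. N $ k $ i * c $ k)" for c i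
    by (simp add: matrix_vector_mult_def transpose_def del: transpose_matrix_vector)
  ultimately have "orth_proj {v. N *v v = 0} (axis j 1) $ i = (if i = j then 1 else 0) -
        (\<Sum>k\<in>UNIV. N $ k $ i * (det (\<chi> a b. if b = k then N $ a $ j else G $ a $ b) / det G))" for i j
    by (simp add: axis_def cong: if_cong del: transpose_matrix_vector)
  then show "proj_matrix {v. N *v v = 0} =
      (\<chi> i j. (if i = j then 1 else 0) -
        (\<Sum>k\<in>UNIV. N $ k $ i * (det (\<chi> a b. if b = k then N $ a $ j else G $ a $ b) / det G)))"
    unfolding proj_matrix_def by presburger
qed

text \<open>The chain rule is applied to both compositions of chart and inverse. The first identity
  recovers velocities of curves, the second gives surjectivity of the derivative of the
  chart.\<close>

lemma chart_derivative_inverse: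
  fixes \<phi> \<psi> :: "real^'S \<Rightarrow> real^'S"
  assumes "open U" "open W"
    and \<phi>: "\<And>x. x \<in> U \<Longrightarrow> \<phi> differentiable (at x)" and \<psi>: "\<And>y. y \<in> W \<Longrightarrow> \<psi> differentiable (at y)"
    and im: "\<phi> ` U = W" and inv: "\<And>x. x \<in> U \<Longrightarrow> \<psi> (\<phi> x) = x" "\<And>y. y \<in> W \<Longrightarrow> \<phi> (\<psi> y) = y"
    and x: "x \<in> U"
  shows "frechet_derivative \<psi> (at (\<phi> x)) (frechet_derivative \<phi> (at x) v) = v"
    and "frechet_derivative \<phi> (at x) (frechet_derivative \<psi> (at (\<phi> x)) v) = v"
proof -
  have xW: "\<phi> x \<in> W" using im x by auto
  define A where "A = frechet_derivative \<phi> (at x)"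
  define B where "B = frechet_derivative \<psi> (at (\<phi> x))"
  have A: "(\<phi> has_derivative A) (at x)" unfolding A_def using \<phi>[OF x] by (simp add: frechet_derivative_works)
  have B: "(\<psi> has_derivative B) (at (\<phi> x))" unfolding B_def using \<psi>[OF xW] by (simp add: frechet_derivative_works)
  have "((\<psi> \<circ> \<phi>) has_derivative (B \<circ> A)) (at x)" using A B by (rule diff_chain_at)
  then have "((\<lambda>x. x) has_derivative (B \<circ> A)) (at x)"
    by (rule has_derivative_transform_within_open[OF _ \<open>open U\<close> x]) (simp add: inv)
  then have "B \<circ> A = (\<lambda>x. x)" using has_derivative_ident by (rule has_derivative_unique)
  then show "frechet_derivative \<psi> (at (\<phi> x)) (frechet_derivative \<phi> (at x) v) = v"
    unfolding A_def B_def by (metis comp_apply)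
  have "(\<phi> has_derivative A) (at (\<psi> (\<phi> x)))" using A x by (simp add: inv)
  with B have "((\<phi> \<circ> \<psi>) has_derivative (A \<circ> B)) (at (\<phi> x))" by (rule diff_chain_at)
  then have "((\<lambda>x. x) has_derivative (A \<circ> B)) (at (\<phi> x))"
    by (rule has_derivative_transform_within_open[OF _ \<open>open W\<close> xW]) (simp add: inv)
  then have "A \<circ> B = (\<lambda>x. x)" using has_derivative_ident by (rule has_derivative_unique)
  then show "frechet_derivative \<phi> (at x) (frechet_derivative \<psi> (at (\<phi> x)) v) = v"
    unfolding A_def B_def by (metis comp_apply)
qed

text \<open>For a curve in \<open>M\<close>, the difference quotients of its image lie in the
  subspace \<open>L\<close>, which is closed, so the limit does too. Conversely, the straight line
  through \<open>\<phi> x\<close> with direction in \<open>L\<close> is pulled back by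
  \<open>\<psi>\<close> to a curve in \<open>M\<close>.\<close>

lemma tangent_space_chart:
  fixes \<phi> \<psi> :: "real^'S \<Rightarrow> real^'S"
  assumes "open U" "open W" "subspace L"
    and \<phi>: "\<And>x. x \<in> U \<Longrightarrow> \<phi> differentiable (at x)" and \<psi>: "\<And>y. y \<in> W \<Longrightarrow> \<psi> differentiable (at y)"
    and im: "\<phi> ` U = W" and inv: "\<And>x. x \<in> U \<Longrightarrow> \<psi> (\<phi> x) = x" "\<And>y. y \<in> W \<Longrightarrow> \<phi> (\<psi> y) = y"
    and M: "\<phi> ` (M \<inter> U) = W \<inter> L" and x: "x \<in> M" "x \<in> U"
  shows "tangent_space M x = {v. frechet_derivative \<phi> (at x) v \<in> L}"
proof -
  have xW: "\<phi> x \<in> W" "\<phi> x \<in> L" using M x by auto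
  define A where "A = frechet_derivative \<phi> (at x)"
  define B where "B = frechet_derivative \<psi> (at (\<phi> x))"
  have A: "(\<phi> has_derivative A) (at x)" unfolding A_def using \<phi>[OF x(2)] by (simp add: frechet_derivative_works)
  have B: "(\<psi> has_derivative B) (at (\<phi> x))" unfolding B_def using \<psi>[OF xW(1)] by (simp add: frechet_derivative_works)
  have BA: "B (A v) = v" for v
    unfolding A_def B_def by (rule chart_derivative_inverse[OF assms(1,2) \<phi> \<psi> im inv x(2)])
  show "tangent_space M x = {v. frechet_derivative \<phi> (at x) v \<in> L}"
    unfolding A_def[symmetric]
  proof (intro set_eqI iffI)
    fix v assume "v \<in> tangent_space M x"
    then obtain \<gamma> where \<gamma>: "\<And>t. t \<in> {-1<..<1} \<Longrightarrow> \<gamma> t \<in> M" "\<gamma> 0 = x" "(\<gamma> has_vector_derivative v) (at 0)"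
      unfolding tangent_space_def by blast
    have "((\<phi> \<circ> \<gamma>) has_vector_derivative A v) (at 0)"
      using \<gamma>(3) A \<gamma>(2) by (intro vector_derivative_diff_chain_within) (auto intro: has_derivative_at_withinI)
    then have lim: "((\<lambda>t. (1 / t) *\<^sub>R (\<phi> (\<gamma> t) - \<phi> x)) \<longlongrightarrow> A v) (at 0)"
    proof -
      have "((\<lambda>t. norm (\<phi> (\<gamma> t) - \<phi> x - t *\<^sub>R A v) / norm t) \<longlongrightarrow> 0) (at 0)"
        using \<open>((\<phi> \<circ> \<gamma>) has_vector_derivative A v) (at 0)\<close> \<gamma>(2)
        unfolding has_vector_derivative_def has_derivative_at by simp
      then have "((\<lambda>t. norm ((1 / t) *\<^sub>R (\<phi> (\<gamma> t) - \<phi> x) - A v)) \<longlongrightarrow> 0) (at 0)"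
      proof (rule Lim_transform_eventually)
        show "\<forall>\<^sub>F t in at 0. norm (\<phi> (\<gamma> t) - \<phi> x - t *\<^sub>R A v) / norm t =
          norm ((1 / t) *\<^sub>R (\<phi> (\<gamma> t) - \<phi> x) - A v)"
          unfolding eventually_at_filter
        proof (intro always_eventually allI impI)
          fix t :: real assume "t \<noteq> 0"
          then have "(1 / t) *\<^sub>R (\<phi> (\<gamma> t) - \<phi> x) - A v = (1 / t) *\<^sub>R (\<phi> (\<gamma> t) - \<phi> x - t *\<^sub>R A v)"
            by (simp add: scaleR_diff_right)
          then show "norm (\<phi> (\<gamma> t) - \<phi> x - t *\<^sub>R A v) / norm t =
            norm ((1 / t) *\<^sub>R (\<phi> (\<gamma> t) - \<phi> x) - A v)" by simp
        qed
      qed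
      then show ?thesis by (rule LIM_zero_cancel[OF tendsto_norm_zero_cancel])
    qed
    have "isCont \<gamma> 0" using \<gamma>(3) by (rule has_vector_derivative_continuous)
    then have "\<forall>\<^sub>F t in at 0. \<gamma> t \<in> U"
      unfolding isCont_def using \<open>open U\<close> x(2) \<gamma>(2) by (intro topological_tendstoD) auto
    moreover have "\<forall>\<^sub>F t in at 0. t \<in> {-1<..<(1::real)}"
      by (rule eventually_at_in_open') auto
    ultimately have "\<forall>\<^sub>F t in at 0. (1 / t) *\<^sub>R (\<phi> (\<gamma> t) - \<phi> x) \<in> L"
    proof eventually_elim
      case (elim t)
      then have "\<phi> (\<gamma> t) \<in> L" using \<gamma>(1) M by auto
      then show ?case using xW \<open>subspace L\<close> by (intro subspace_scale subspace_diff)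
    qed
    then have "A v \<in> L"
      using lim closed_subspace[OF \<open>subspace L\<close>] by (intro Lim_in_closed_set) auto
    then show "v \<in> {v. A v \<in> L}" by simp
  next
    fix v assume "v \<in> {v. A v \<in> L}"
    then have w: "A v \<in> L" by simp
    \<comment> \<open>The constant value \<open>x\<close> keeps the curve in \<open>M\<close> on the
      whole parameter interval; since \<open>W\<close> is open, the derivative at 0 is
      unaffected.\<close>
    define \<gamma> where "\<gamma> t = (if \<phi> x + t *\<^sub>R A v \<in> W then \<psi> (\<phi> x + t *\<^sub>R A v) else x)" for t
    have "\<gamma> t \<in> M" for t
    proof (cases "\<phi> x + t *\<^sub>R A v \<in> W")
      case True
      moreover have "\<phi> x + t *\<^sub>R A v \<in> L" using w xW \<open>subspace L\<close> by (intro subspace_add subspace_scale)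
      ultimately have "\<phi> x + t *\<^sub>R A v \<in> \<phi> ` (M \<inter> U)" unfolding M by blast
      then obtain y where "y \<in> M" "y \<in> U" "\<phi> x + t *\<^sub>R A v = \<phi> y" by blast
      then show ?thesis using True inv by (simp add: \<gamma>_def)
    qed (simp add: \<gamma>_def x)
    moreover have "\<gamma> 0 = x" using xW inv x by (simp add: \<gamma>_def)
    moreover have "(\<gamma> has_vector_derivative v) (at 0)"
    proof -
      have "((\<lambda>t. \<phi> x + t *\<^sub>R A v) has_vector_derivative A v) (at 0)"
        by (auto intro!: derivative_eq_intros)
      moreover have "(\<psi> has_derivative B) (at (\<phi> x + 0 *\<^sub>R A v) within range (\<lambda>t. \<phi> x + t *\<^sub>R A v))"
        using B by (auto intro: has_derivative_at_withinI)
      ultimately have *: "((\<psi> \<circ> (\<lambda>t. \<phi> x + t *\<^sub>R A v)) has_vector_derivative B (A v)) (at 0)"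
        by (rule vector_derivative_diff_chain_within)
      have op: "open ((\<lambda>t. \<phi> x + t *\<^sub>R A v) -` W)"
        by (intro open_vimage \<open>open W\<close> continuous_intros)
      have "(\<gamma> has_vector_derivative B (A v)) (at 0)"
        by (rule has_vector_derivative_transform_within_open[OF * op]) (auto simp: \<gamma>_def xW)
      then show ?thesis by (simp add: BA)
    qed
    ultimately show "v \<in> tangent_space M x" unfolding tangent_space_def
      by (intro CollectI exI[of _ \<gamma>]) simp
  qed
qed

text \<open>The tangent space is the kernel of R D, where D is the derivative of the chart. The
  rational formula for the projection onto such a kernel makes sense on all of \<open>U\<close>, so
  \<open>Q\<close> extends the projection field off \<open>M\<close> as a C^1 map.\<close>

lemma submanifold_local_projection:
  fixes M :: "(real^'S) set"
  assumes "submanifold n M" "p \<in> M"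
  obtains U Q where "open U" "p \<in> U" "Ck_on 1 Q U" "\<And>x. x \<in> M \<Longrightarrow> x \<in> U \<Longrightarrow> Qmap M x = Q x"
    "\<And>x. x \<in> M \<Longrightarrow> x \<in> U \<Longrightarrow> subspace (tangent_space M x)"
proof -
  obtain U W L and \<phi> \<psi> :: "real^'S \<Rightarrow> real^'S" where U: "open U" "p \<in> U" and W: "open W" and L: "subspace L"
    and sm: "smooth_on \<phi> U" "smooth_on \<psi> W" and im: "\<phi> ` U = W"
    and inv: "\<And>x. x\<in>U \<Longrightarrow> \<psi> (\<phi> x) = x" "\<And>y. y\<in>W \<Longrightarrow> \<phi> (\<psi> y) = y" and M: "\<phi> ` (M \<inter> U) = W \<inter> L"
    using assms unfolding submanifold_def by metis
  \<comment> \<open>Two orders are taken from \<open>\<phi>\<close>, because \<open>Q\<close> is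
    built from its first derivative and must itself be C^1.\<close>
  have "Ck_on (Suc 1) \<phi> U" "Ck_on (Suc 0) \<psi> W" using sm unfolding smooth_on_def by blast+
  then have d\<phi>: "\<And>x. x \<in> U \<Longrightarrow> \<phi> differentiable (at x)" and d\<psi>: "\<And>y. y \<in> W \<Longrightarrow> \<psi> differentiable (at y)"
    and C1: "\<And>v. Ck_on 1 (\<lambda>x. frechet_derivative \<phi> (at x) v) U"
    by auto
  have tan: "tangent_space M x = {v. frechet_derivative \<phi> (at x) v \<in> L}" if "x \<in> M" "x \<in> U" for x
    by (rule tangent_space_chart[OF U(1) W L d\<phi> d\<psi> im inv M that])
  have derinv: "frechet_derivative \<phi> (at x) (frechet_derivative \<psi> (at (\<phi> x)) v) = v" if "x \<in> U" for x v
    by (rule chart_derivative_inverse(2)[OF U(1) W d\<phi> d\<psi> im inv that])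
  obtain R :: "real^'S^'S" where R: "transpose R = R" "R ** R = R" "\<And>w. R *v w = 0 \<longleftrightarrow> w \<in> L"
    by (rule orthogonal_complement_matrix[OF L]) blast
  define D where "D x = matrix (frechet_derivative \<phi> (at x))" for x
  have lin: "linear (frechet_derivative \<phi> (at x))" if "x \<in> U" for x
    using d\<phi>[OF that] by (rule linear_frechet_derivative)
  have Dv: "D x *v v = frechet_derivative \<phi> (at x) v" if "x \<in> U" for x v
    unfolding D_def by (rule matrix_works) (use lin[OF that] in \<open>simp add: linear_def scalar_mult_eq_scaleR\<close>)
  define N where "N x = R ** D x" for x
  define G where "G x = N x ** transpose (N x) + (mat 1 - R)" for x
  \<comment> \<open>Subtraction is spelled as adding -1 times a term, so that the closure rules for
    sums and products apply directly.\<close>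
  define Q :: "real^'S \<Rightarrow> real^'S^'S" where "Q x = (\<chi> i j. (if i = j then 1 else 0) + (- 1) *
        (\<Sum>k\<in>UNIV. N x $ k $ i * (det (\<chi> a b. if b = k then N x $ a $ j else G x $ a $ b) / det (G x))))" for x
  have RN: "R ** N x = N x" for x by (simp add: N_def matrix_mul_assoc R)
  \<comment> \<open>Since \<open>R\<close> fixes \<open>u\<close>, the assumption on
    \<open>N x\<close> becomes D^T u = 0. As D is surjective, u = D w for some w, and u . u = (D^T
    u) . w = 0.\<close>
  have inj: "u = 0" if xU: "x \<in> U" and Ru: "R *v u = u" and Nu: "transpose (N x) *v u = 0" for x u
  proof -
    have "transpose (D x) *v u = 0"
      using Nu unfolding N_def matrix_transpose_mul R(1) matrix_vector_mul_assoc[symmetric] Ru .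
    moreover have "\<exists>w. D x *v w = u" unfolding Dv[OF xU] using derinv[OF xU] by blast
    then obtain w where "D x *v w = u" by blast
    ultimately have "u \<bullet> u = 0"
      by (metis dot_lmul_matrix inner_zero_left transpose_matrix_vector)
    then show ?thesis by simp
  qed
  have detG: "det (G x) \<noteq> 0" if "x \<in> U" for x
    unfolding G_def by (rule orth_proj_kernel_matrix(1)[OF R(1,2) RN inj[OF that]])
  have proj: "proj_matrix {v. N x *v v = 0} = Q x" if "x \<in> U" for x
    unfolding Q_def G_def using orth_proj_kernel_matrix(2)[OF R(1,2) RN inj[OF that]] by simp
  have NL: "{v. N x *v v = 0} = tangent_space M x" if "x \<in> M" "x \<in> U" for x
    using tan[OF that] by (simp add: N_def R(3) Dv[OF that(2)] flip: matrix_vector_mul_assoc)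
  show thesis
  proof (rule that[OF U])
    have D1: "Ck_on 1 (\<lambda>x. D x $ i $ j) U" for i j
      unfolding D_def matrix_def by (simp only: vec_lambda_beta) (intro Ck_on_1_nth C1)
    have N1: "Ck_on 1 (\<lambda>x. N x $ i $ j) U" for i j
      unfolding N_def matrix_matrix_mult_def
      by (simp only: vec_lambda_beta) (intro Ck_on_1_sum Ck_on_1_mult Ck_on_1_const D1 finite)
    have G1: "Ck_on 1 (\<lambda>x. G x $ i $ j) U" for i j
      unfolding G_def matrix_matrix_mult_def transpose_def vector_add_component
      by (simp only: vec_lambda_beta) (intro Ck_on_1_add Ck_on_1_sum Ck_on_1_mult Ck_on_1_const N1 finite)
    have "Ck_on 1 (\<lambda>x. (\<chi> a b. if b = k then N x $ a $ j else G x $ a $ b) $ a $ b) U" for a b k j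
      using N1[of a j] G1[of a b] by (cases "b = k") simp_all
    then show "Ck_on 1 Q U" unfolding Q_def[abs_def]
      by (intro Ck_on_1_vec_lambda Ck_on_1_add Ck_on_1_mult Ck_on_1_sum Ck_on_1_divide Ck_on_1_const
          Ck_on_1_det N1 G1 finite) (use detG in auto)
    fix x assume x: "x \<in> M" "x \<in> U"
    show "Qmap M x = Q x"
      unfolding Qmap_def NL[OF x, symmetric] by (rule proj[OF x(2)])
    show "subspace (tangent_space M x)" unfolding NL[OF x, symmetric]
      by (auto simp: subspace_def matrix_vector_right_distrib matrix_vector_mult_scaleR)
  qed
qed

lemma orth_proj_works:
  assumes "subspace L"
  shows "orth_proj L v \<in> L" and "z \<in> L \<Longrightarrow> (v - orth_proj L v) \<bullet> z = 0"
proof -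
  obtain y z where yz: "y \<in> span L" "\<And>w. w \<in> span L \<Longrightarrow> orthogonal z w" "v = y + z"
    by (rule orthogonal_subspace_decomp_exists[of L v]) blast
  have sp: "span L = L" using assms by (simp add: span_eq_iff)
  have "orth_proj L v = y"
    by (rule orth_proj_unique[OF assms]) (use yz sp in \<open>auto simp: orthogonal_def\<close>)
  then show "orth_proj L v \<in> L" "z \<in> L \<Longrightarrow> (v - orth_proj L v) \<bullet> z = 0" for z
    using yz sp by (auto simp: orthogonal_def)
qed

lemma proj_matrix_mult_vec:
  assumes "subspace L"
  shows "proj_matrix L *v v = orth_proj L v"
proof -
  have eq: "proj_matrix L *v v = (\<Sum>j\<in>UNIV. v $ j *\<^sub>R orth_proj L (axis j 1))"
    by (simp add: proj_matrix_def matrix_vector_mult_def vec_eq_iff mult.commute)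
  have v: "v = (\<Sum>j\<in>UNIV. v $ j *\<^sub>R axis j 1)"
    using basis_expansion[of v] by (simp add: scalar_mult_eq_scaleR)
  have d: "v - proj_matrix L *v v = (\<Sum>j\<in>UNIV. v $ j *\<^sub>R (axis j 1 - orth_proj L (axis j 1)))"
    unfolding eq by (subst (1) v) (simp add: scaleR_diff_right sum_subtractf)
  show ?thesis
    by (rule orth_proj_unique[OF assms, symmetric])
      (auto simp: d inner_sum_left orth_proj_works[OF assms], auto simp: eq intro!: subspace_sum subspace_scale orth_proj_works assms)
qed

lemma proj_matrix_fix_iff:
  assumes "subspace L"
  shows "proj_matrix L *v v = v \<longleftrightarrow> v \<in> L"
proof
  assume "proj_matrix L *v v = v"
  then show "v \<in> L" using orth_proj_works(1)[OF assms] by (metis proj_matrix_mult_vec[OF assms])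
next
  assume "v \<in> L"
  then show "proj_matrix L *v v = v" unfolding proj_matrix_mult_vec[OF assms]
    by (intro orth_proj_unique assms) auto
qed

section \<open>Compactness of the Grassmannian and of the bundle of tangent planes\<close>

lemma continuous_on_matrix_mult:
  fixes f g :: "'a::topological_space \<Rightarrow> real^'n^'n"
  assumes "continuous_on S f" "continuous_on S g"
  shows "continuous_on S (\<lambda>x. f x ** g x)"
  unfolding matrix_matrix_mult_def by (intro continuous_intros assms)

lemma norm_matrix_vector_mult_le: "norm ((A::real^'n^'m) *v v) \<le> norm A * norm v"
proof -
  have "norm (A *v v) = L2_set (\<lambda>i. norm (A $ i \<bullet> v)) UNIV"
    by (simp add: norm_vec_def[of "A *v v"] matrix_vector_mul_component)
  also have "\<dots> \<le> L2_set (\<lambda>i. norm (A $ i) * norm v) UNIV"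
    by (intro L2_set_mono) (auto intro: Cauchy_Schwarz_ineq2)
  also have "\<dots> = norm A * norm v" by (simp add: norm_vec_def[of A] L2_set_left_distrib)
  finally show ?thesis .
qed

text \<open>The range of \<open>P\<close> is fixed pointwise. A vector \<open>v\<close> in it killed
  by \<open>P'\<close> satisfies |v| = |(P - P') v|, which is less than |v| unless v = 0; so
  \<open>P'\<close> is injective on this range.\<close>

lemma rank_le_of_idempotent_near:
  fixes P P' :: "real^'n^'n"
  assumes "P ** P = P" "norm (P - P') < 1"
  shows "rank P \<le> rank P'"
proof -
  have z: "v = 0" if "P *v v = v" "P' *v v = 0" for v
  proof (rule ccontr)
    assume "v \<noteq> 0"
    have "norm v = norm ((P - P') *v v)" using that by (simp add: matrix_vector_mult_diff_rdistrib)
    also have "\<dots> \<le> norm (P - P') * norm v" by (rule norm_matrix_vector_mult_le)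
    also have "\<dots> < 1 * norm v" using assms \<open>v \<noteq> 0\<close> by (intro mult_strict_right_mono) auto
    finally show False by simp
  qed
  have fixP: "P *v v = v" if "v \<in> range ((*v) P)" for v
    using that assms(1) by (auto simp: matrix_vector_mul_assoc)
  have sub: "subspace (range ((*v) P))"
    by (intro linear_subspace_image subspace_UNIV matrix_vector_mul_linear)
  have inj: "inj_on ((*v) P') (range ((*v) P))"
  proof (rule inj_onI)
    fix v w assume v: "v \<in> range ((*v) P)" "w \<in> range ((*v) P)" "P' *v v = P' *v w"
    then have "v - w \<in> range ((*v) P)" using sub by (intro subspace_diff)
    moreover have "P' *v (v - w) = 0" using v(3) by (simp add: matrix_vector_mult_diff_distrib)
    ultimately have "v - w = 0" using z fixP by blast
    then show "v = w" by simp
  qed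
  have "rank P = dim (range ((*v) P))" by (rule rank_dim_range)
  also have "\<dots> = dim ((*v) P' ` range ((*v) P))"
    by (rule dim_image_eq[symmetric]) (use inj sub in \<open>auto simp: span_eq_iff[THEN iffD2]\<close>)
  also have "\<dots> \<le> dim (range ((*v) P'))" by (rule dim_subset) auto
  also have "\<dots> = rank P'" by (rule rank_dim_range[symmetric])
  finally show ?thesis .
qed

text \<open>Each row has norm at most 1, being the image of a unit vector under an orthogonal
  projection. Symmetry and idempotence are closed conditions, and the rank passes to the limit
  because nearby idempotents have equal rank, by the comparison in both directions.\<close>

lemma compact_Grass: "compact (Grass m :: (real^'S^'S) set)"
proof -
  have "norm P \<le> real CARD('S)" if P: "P \<in> Grass m" for P :: "real^'S^'S"
  proof -
    have P: "transpose P = P" "P ** P = P" using P by (auto simp: Grass_def)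
    have "norm (P $ i) \<le> 1" for i
    proof -
      have "P *v axis i 1 = P $ i"
        unfolding matrix_vector_mult_basis by (subst P(1)[symmetric]) (simp add: vec_eq_iff column_def transpose_def)
      then have "P $ i \<bullet> P $ i = (P *v axis i 1) \<bullet> (P *v axis i 1)" by simp
      also have "\<dots> = axis i 1 \<bullet> (transpose P *v (P *v axis i 1))"
        by (metis dot_lmul_matrix inner_commute transpose_matrix_vector)
      also have "\<dots> = axis i 1 \<bullet> P $ i" using \<open>P *v axis i 1 = P $ i\<close> 
        unfolding P(1) matrix_vector_mul_assoc P(2) by simp
      also have "\<dots> \<le> norm (axis i 1 :: real^'S) * norm (P $ i)" by (rule norm_cauchy_schwarz)
      finally have "norm (P $ i) * norm (P $ i) \<le> norm (P $ i)"
        by (simp add: norm_axis_1 flip: power2_eq_square power2_norm_eq_inner)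
      then show ?thesis by (cases "norm (P $ i) = 0") auto
    qed
    then have "(\<Sum>i\<in>UNIV. norm (P $ i)) \<le> (\<Sum>i\<in>(UNIV::'S set). 1)" by (intro sum_mono) auto
    moreover have "norm P \<le> (\<Sum>i\<in>UNIV. norm (P $ i))"
      unfolding norm_vec_def[of P] by (rule L2_set_le_sum) auto
    ultimately show ?thesis by simp
  qed
  then have "bounded (Grass m :: (real^'S^'S) set)" by (auto simp: bounded_iff)
  moreover have "closed (Grass m :: (real^'S^'S) set)"
    unfolding closed_sequential_limits
  proof (intro allI impI, elim conjE)
    fix X and P :: "real^'S^'S" assume X: "\<forall>n. X n \<in> Grass m" and lim: "X \<longlonglongrightarrow> P"
    have "closed {P::real^'S^'S. transpose P = P}"
      by (intro closed_Collect_eq continuous_intros) (auto simp: transpose_def intro!: continuous_intros)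
    moreover have "closed {P::real^'S^'S. P ** P = P}"
      by (intro closed_Collect_eq continuous_on_matrix_mult continuous_intros)
    ultimately have P: "transpose P = P" "P ** P = P"
      using closed_sequentially[OF _ _ lim] X by (auto simp: Grass_def)
    from lim obtain k where "dist (X k) P < 1"
      unfolding lim_sequentially by (meson le_refl zero_less_one)
    then have "norm (X k - P) < 1" "norm (P - X k) < 1" by (auto simp: dist_norm norm_minus_commute)
    then have "rank P = rank (X k)" using X P
      by (intro antisym rank_le_of_idempotent_near) (auto simp: Grass_def)
    then show "P \<in> Grass m" using P X by (auto simp: Grass_def)
  qed
  ultimately show ?thesis by (simp add: compact_eq_bounded_closed)
qed

lemma subspace_tangent_space:
  assumes "submanifold n M" "x \<in> M" shows "subspace (tangent_space M x)"
proof -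
  obtain U where "x \<in> U" "\<And>y. y \<in> M \<Longrightarrow> y \<in> U \<Longrightarrow> subspace (tangent_space M y)"
    by (rule submanifold_local_projection[OF assms]) blast
  then show ?thesis using assms(2) by blast
qed

lemma continuous_on_local:
  fixes f :: "'a::t2_space \<Rightarrow> 'b::topological_space"
  assumes "\<And>x. x \<in> S \<Longrightarrow> \<exists>A g. open A \<and> x \<in> A \<and> continuous_on (S \<inter> A) g \<and> (\<forall>y\<in>S \<inter> A. g y = f y)"
  shows "continuous_on S f"
  unfolding continuous_on_eq_continuous_within
proof
  fix x assume x: "x \<in> S"
  then obtain A g where A: "open A" "x \<in> A" "continuous_on (S \<inter> A) g" "\<forall>y\<in>S \<inter> A. g y = f y"
    using assms[OF x] by blast
  then have "continuous_on (S \<inter> A) f" by (intro continuous_on_eq[OF A(3)]) auto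
  then have "continuous (at x within S \<inter> A) f" using x A by (simp add: continuous_on_eq_continuous_within)
  moreover have "at x within S \<inter> A = at x within S"
    by (rule at_within_nhd[of x A]) (use A in auto)
  ultimately show "continuous (at x within S) f" by simp
qed

lemma continuous_on_Qmap:
  assumes "submanifold n M" shows "continuous_on M (Qmap M)"
proof (rule continuous_on_local)
  fix p assume "p \<in> M"
  then obtain U Q where "open U" "p \<in> U" "Ck_on 1 Q U" "\<And>x. x \<in> M \<Longrightarrow> x \<in> U \<Longrightarrow> Qmap M x = Q x"
    using submanifold_local_projection[OF assms] by metis
  then show "\<exists>A g. open A \<and> p \<in> A \<and> continuous_on (M \<inter> A) g \<and> (\<forall>y\<in>M \<inter> A. g y = Qmap M y)"
    by (intro exI[of _ U] exI[of _ Q])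
      (auto intro: continuous_on_subset[OF Ck_on_1_imp_continuous_on])
qed

text \<open>Tangent vectors are exactly those fixed by the projection \<open>Q\<close>, so inclusion
  of the plane amounts to Q P = P. Being an equation between continuous maps, it defines a closed
  condition.\<close>

lemma Gm_iff:
  assumes "submanifold n Nbar" "N \<subseteq> Nbar"
  shows "Gm Nbar m N = {z \<in> N \<times> Grass m. Qmap Nbar (fst z) ** snd z - snd z = 0}"
proof -
  have "range ((*v) P) \<subseteq> tangent_space Nbar x \<longleftrightarrow> Qmap Nbar x ** P = P" if "x \<in> N" for x P
    using proj_matrix_fix_iff[OF subspace_tangent_space[OF assms(1)], of x] that assms(2)
    unfolding Qmap_def matrix_eq matrix_vector_mul_assoc[symmetric] by blast
  then show ?thesis unfolding Gm_def
    by (intro set_eqI) (simp add: case_prod_beta mem_Times_iff, blast)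
qed

lemma compact_Gm:
  assumes "submanifold n Nbar" "N \<subseteq> Nbar" "compact N"
  shows "compact (Gm Nbar m N)"
proof -
  have c: "compact (N \<times> Grass m)" using assms(3) compact_Grass by (rule compact_Times)
  have "continuous_on (N \<times> Grass m) (\<lambda>z. Qmap Nbar (fst z) ** snd z - snd z)"
    by (intro continuous_intros continuous_on_matrix_mult
        continuous_on_compose2[OF continuous_on_Qmap[OF assms(1)]]) (use assms(2) in auto)
  then have "closed (Gm Nbar m N)" unfolding Gm_iff[OF assms(1,2)]
    by (rule continuous_closed_preimage_constant) (rule compact_imp_closed[OF c])
  then have "compact (N \<times> Grass m \<inter> Gm Nbar m N)" by (rule compact_Int_closed[OF c])
  moreover have "N \<times> Grass m \<inter> Gm Nbar m N = Gm Nbar m N" by (auto simp: Gm_def)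
  ultimately show ?thesis by simp
qed

section \<open>Continuity of the curvature term\<close>

text \<open>This is the part of \<open>HN\<close> that does not involve \<open>H\<close>; row j of
  \<open>P\<close> is the direction \<Sum>k P_jk e_k.\<close>

definition ambient_curvature :: "(real^'S) set \<Rightarrow> (real^'S) \<times> (real^'S^'S) \<Rightarrow> real^'S" where
  "ambient_curvature Nbar z = (\<chi> i. \<Sum>j\<in>UNIV.
       frechet_derivative (Qmap Nbar) (at (fst z) within Nbar) (row j (snd z)) $ i $ j)"

text \<open>A derivative within \<open>M\<close> need not be unique, and
  \<open>frechet_derivative\<close> merely selects one. In a tangent direction, however, every
  choice equals the velocity of \<open>q\<close> along a curve in \<open>M\<close>.\<close>

lemma frechet_derivative_within_tangent:
  assumes "open U" "x \<in> U" "x \<in> M" "Q differentiable (at x)"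
    and eq: "\<And>y. y \<in> M \<Longrightarrow> y \<in> U \<Longrightarrow> q y = Q y" and v: "v \<in> tangent_space M x"
  shows "frechet_derivative q (at x within M) v = frechet_derivative Q (at x) v"
proof -
  define D where "D = frechet_derivative Q (at x)"
  define E where "E = frechet_derivative q (at x within M)"
  obtain d where d: "d > 0" "ball x d \<subseteq> U" using assms(1,2) open_contains_ball by blast
  have "(Q has_derivative D) (at x within M)"
    unfolding D_def using assms(4) by (simp add: frechet_derivative_works has_derivative_at_withinI)
  then have D: "(q has_derivative D) (at x within M)"
    by (rule has_derivative_transform_within[OF _ d(1) assms(3)])
      (metis d(2) dist_commute eq mem_ball subsetD)
  then have E: "(q has_derivative E) (at x within M)"
    unfolding E_def using frechet_derivative_works differentiable_def by blast
  obtain \<gamma> where \<gamma>: "\<And>t. t \<in> {-1<..<1} \<Longrightarrow> \<gamma> t \<in> M" "\<gamma> 0 = x" "(\<gamma> has_vector_derivative v) (at 0)"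
    using v unfolding tangent_space_def by blast
  have \<gamma>': "(\<gamma> has_vector_derivative v) (at 0 within {-1<..<1})"
    using \<gamma>(3) by (rule has_vector_derivative_at_within)
  have im: "\<gamma> ` {-1<..<1} \<subseteq> M" using \<gamma>(1) by auto
  have at: "at 0 within {-1<..<1} = at (0::real)" by (rule at_within_open) auto
  have "((q \<circ> \<gamma>) has_vector_derivative D v) (at 0 within {-1<..<1})"
    using \<gamma>' by (rule vector_derivative_diff_chain_within) (simp add: \<gamma>(2) has_derivative_subset[OF D im])
  moreover have "((q \<circ> \<gamma>) has_vector_derivative E v) (at 0 within {-1<..<1})"
    using \<gamma>' by (rule vector_derivative_diff_chain_within) (simp add: \<gamma>(2) has_derivative_subset[OF E im])
  ultimately show ?thesis unfolding D_def E_def at by (rule vector_derivative_unique_at[symmetric])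
qed

text \<open>\<open>Ck_on\<close> gives continuity for each fixed direction. Expanding a moving
  direction in coordinates turns this into joint continuity.\<close>

lemma Ck_on_1_derivative_continuous:
  assumes C1: "Ck_on 1 Q U" and f: "continuous_on S f" "\<And>z. z \<in> S \<Longrightarrow> f z \<in> U" and g: "continuous_on S g"
  shows "continuous_on S (\<lambda>z. frechet_derivative Q (at (f z)) (g z))"
proof -
  have "continuous_on S (\<lambda>z. \<Sum>k\<in>UNIV. g z $ k *\<^sub>R frechet_derivative Q (at (f z)) (axis k 1))"
  proof (intro continuous_intros g)
    show "continuous_on S (\<lambda>z. frechet_derivative Q (at (f z)) (axis k 1))" for k
      by (rule continuous_on_compose2[OF _ f(1), of U]) (use C1 f in auto)
  qed
  then show ?thesis
  proof (rule continuous_on_eq)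
    fix z assume z: "z \<in> S"
    have lin: "linear (frechet_derivative Q (at (f z)))"
      using C1 f(2)[OF z] by (intro linear_frechet_derivative) auto
    have e: "(\<Sum>k\<in>UNIV. g z $ k *\<^sub>R axis k 1) = g z"
      using basis_expansion[of "g z"] by (simp add: scalar_mult_eq_scaleR)
    have "(\<Sum>k\<in>UNIV. g z $ k *\<^sub>R frechet_derivative Q (at (f z)) (axis k 1)) =
        frechet_derivative Q (at (f z)) (\<Sum>k\<in>UNIV. g z $ k *\<^sub>R axis k 1)"
      by (simp add: linear_sum[OF lin] linear_scale[OF lin])
    then show "(\<Sum>k\<in>UNIV. g z $ k *\<^sub>R frechet_derivative Q (at (f z)) (axis k 1)) =
        frechet_derivative Q (at (f z)) (g z)" unfolding e .
  qed
qed

text \<open>Near each point the projection field is replaced by its local C^1 extension. Only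
  derivatives in the directions of the rows of \<open>P\<close> occur, and these are tangent, so the
  replacement does not change them.\<close>

lemma continuous_on_ambient_curvature:
  assumes "submanifold n Nbar" "N \<subseteq> Nbar"
  shows "continuous_on (Gm Nbar m N) (ambient_curvature Nbar)"
proof (rule continuous_on_local)
  fix z0 assume z0: "z0 \<in> Gm Nbar m N"
  then have "fst z0 \<in> Nbar" using assms(2) by (auto simp: Gm_def)
  then obtain U Q where U: "open U" "fst z0 \<in> U" and Q: "Ck_on 1 Q U"
    and eq: "\<And>x. x \<in> Nbar \<Longrightarrow> x \<in> U \<Longrightarrow> Qmap Nbar x = Q x"
    using submanifold_local_projection[OF assms(1)] by metis
  define g where "g z = (\<chi> i. \<Sum>j\<in>UNIV. frechet_derivative Q (at (fst z)) (row j (snd z)) $ i $ j)"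
    for z :: "(real^'a) \<times> (real^'a^'a)"
  have "continuous_on (Gm Nbar m N \<inter> U \<times> UNIV) g" unfolding g_def row_def
    by (intro continuous_intros Ck_on_1_derivative_continuous[OF Q]) auto
  moreover have "g z = ambient_curvature Nbar z" if z: "z \<in> Gm Nbar m N \<inter> U \<times> UNIV" for z
  proof -
    have x: "fst z \<in> U" "fst z \<in> Nbar" using z assms(2) by (auto simp: Gm_def)
    have P: "transpose (snd z) = snd z" "range ((*v) (snd z)) \<subseteq> tangent_space Nbar (fst z)"
      using z by (auto simp: Gm_def Grass_def)
    have "row j (snd z) \<in> tangent_space Nbar (fst z)" for j
    proof -
      \<comment> \<open>By symmetry of \<open>P\<close>, its rows are columns and hence lie in its
        range.\<close>
      have "row j (snd z) = snd z *v axis j 1"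
        unfolding matrix_vector_mult_basis by (metis P(1) row_transpose)
      then show ?thesis using P(2) by auto
    qed
    moreover have "Q differentiable (at (fst z))" using Q x by auto
    ultimately show ?thesis unfolding g_def ambient_curvature_def
      using frechet_derivative_within_tangent[OF U(1) x, of Q "Qmap Nbar"] eq by (simp add: vec_eq_iff)
  qed
  moreover have "open (U \<times> (UNIV :: (real^'a^'a) set))" using U by (intro open_Times) auto
  moreover have "z0 \<in> U \<times> UNIV" using U by (auto simp: mem_Times_iff)
  ultimately show "\<exists>A g. open A \<and> z0 \<in> A \<and> continuous_on (Gm Nbar m N \<inter> A) g \<and>
      (\<forall>y\<in>Gm Nbar m N \<inter> A. g y = ambient_curvature Nbar y)" by blast
qed

section \<open>First variation estimates and the limit varifold\<close>

text \<open>On the compact product of \<open>G\<close> with the sphere of radius \<delta>,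
  \<open>F\<close> has a positive minimum \<open>c0\<close>. Convexity along rays from 0, where
  \<open>F\<close> vanishes, propagates this to linear growth outside the sphere; inside it the left
  side is not positive.\<close>

lemma condF_lower_bound:
  fixes G :: "((real^'S) \<times> (real^'S^'S)) set"
  assumes F: "condF G F" and G: "compact G" and "\<delta> > 0"
  obtains c where "c > 0" "\<And>z q. z \<in> G \<Longrightarrow> c * (norm q - \<delta>) \<le> F z q"
proof -
  have cont: "continuous_on (G \<times> UNIV) (\<lambda>(z, q). F z q)"
    and nn: "\<And>z q. z \<in> G \<Longrightarrow> F z q \<ge> 0" and zero: "\<And>z q. z \<in> G \<Longrightarrow> F z q = 0 \<longleftrightarrow> q = 0"
    and conv: "\<And>z. z \<in> G \<Longrightarrow> convex_on UNIV (F z)"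
    using F by (auto simp: condF_def)
  have comp: "compact (G \<times> sphere (0::real^'S) \<delta>)" using G by (intro compact_Times) auto
  have cont': "continuous_on (G \<times> sphere 0 \<delta>) (\<lambda>(z, q). F z q)"
    using cont by (rule continuous_on_subset) auto
  obtain c0 where c0: "c0 > 0" "\<And>z q. z \<in> G \<Longrightarrow> norm q = \<delta> \<Longrightarrow> c0 \<le> F z q"
  proof (cases "G \<times> sphere (0::real^'S) \<delta> = {}")
    case True
    then have "G = {}" using \<open>\<delta> > 0\<close> by auto
    then show ?thesis using that[of 1] by auto
  next
    case False
    from continuous_attains_inf[OF comp False cont'] obtain w where
      w: "w \<in> G \<times> sphere 0 \<delta>" "\<forall>y\<in>G \<times> sphere 0 \<delta>. (case w of (z, q) \<Rightarrow> F z q) \<le> (case y of (z, q) \<Rightarrow> F z q)"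
      by blast
    obtain z1 q1 where "w = (z1, q1)" by (cases w)
    with w have m: "z1 \<in> G" "norm q1 = \<delta>" "\<And>z q. z \<in> G \<Longrightarrow> norm q = \<delta> \<Longrightarrow> F z1 q1 \<le> F z q"
      by auto
    have "q1 \<noteq> 0" using m(2) \<open>\<delta> > 0\<close> by auto
    then have "F z1 q1 > 0" using nn[OF m(1), of q1] zero[OF m(1), of q1] by simp
    then show ?thesis using that m(3) by blast
  qed
  show thesis
  proof (rule that[of "c0 / \<delta>"])
    show "c0 / \<delta> > 0" using c0 \<open>\<delta> > 0\<close> by simp
    fix z and q :: "real^'S" assume z: "z \<in> G"
    show "c0 / \<delta> * (norm q - \<delta>) \<le> F z q"
    proof (cases "norm q \<le> \<delta>")
      case True
      then have "c0 / \<delta> * (norm q - \<delta>) \<le> 0" using c0(1) \<open>\<delta> > 0\<close> by (intro mult_nonneg_nonpos) auto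
      also have "0 \<le> F z q" by (rule nn[OF z])
      finally show ?thesis .
    next
      case False
      \<comment> \<open>The factor that scales \<open>q\<close> back onto the sphere of radius
        \<delta>.\<close>
      define t where "t = \<delta> / norm q"
      have q: "norm q > 0" using False \<open>\<delta> > 0\<close> by linarith
      have t: "0 < t" "t \<le> 1" using False q \<open>\<delta> > 0\<close> by (simp_all add: t_def divide_le_eq)
      have "norm (t *\<^sub>R q) = \<delta>" using q \<open>\<delta> > 0\<close> by (simp add: t_def)
      then have "c0 \<le> F z (t *\<^sub>R q)" by (rule c0(2)[OF z])
      also have "F z (t *\<^sub>R q) = F z ((1 - t) *\<^sub>R 0 + t *\<^sub>R q)" by simp
      also have "\<dots> \<le> (1 - t) * F z 0 + t * F z q"
        using t by (intro convex_onD[OF conv[OF z]]) auto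
      also have "\<dots> = t * F z q" using zero[OF z, of 0] by simp
      finally have "c0 * norm q \<le> \<delta> * F z q" using q by (simp add: t_def field_simps)
      then have "c0 / \<delta> * norm q \<le> F z q" using \<open>\<delta> > 0\<close> by (simp add: field_simps)
      moreover have "c0 / \<delta> * (norm q - \<delta>) \<le> c0 / \<delta> * norm q"
        using c0(1) \<open>\<delta> > 0\<close> by (intro mult_left_mono) auto
      ultimately show ?thesis by linarith
    qed
  qed
qed

lemma HN_eq: "HN Nbar H z = H z - ambient_curvature Nbar z"
  by (simp add: HN_def ambient_curvature_def)

lemma varifold_finite_measure:
  assumes V: "varifold Nbar m N V" and G: "compact (Gm Nbar m N)"
  shows "finite_measure V"
proof
  have s: "sets V = sets borel" using V by (simp add: varifold_def)
  have "emeasure V (space V) = emeasure V (Gm Nbar m N)"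
  proof (rule emeasure_eq_AE)
    show "AE x in V. (x \<in> space V) = (x \<in> Gm Nbar m N)"
      using V by (auto simp: varifold_def sets_eq_imp_space_eq[OF s])
    show "Gm Nbar m N \<in> sets V" unfolding s using G by (simp add: borel_compact)
  qed simp
  also have "\<dots> < \<infinity>" using V G by (simp add: varifold_def)
  finally show "emeasure V (space V) \<noteq> \<infinity>" by simp
qed

lemma integrable_continuous_on_compact:
  fixes f :: "'a::euclidean_space \<Rightarrow> 'b::euclidean_space"
  assumes "finite_measure V" "sets V = sets borel" "compact G" "continuous_on G f"
  shows "integrable V (\<lambda>z. indicator G z *\<^sub>R f z)"
proof -
  interpret finite_measure V by fact
  have "bounded (f ` G)" using assms by (intro compact_imp_bounded compact_continuous_image)
  then obtain B where B: "B > 0" "\<And>z. z \<in> G \<Longrightarrow> norm (f z) \<le> B" by (auto simp: bounded_pos)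
  have "(\<lambda>z. indicator G z *\<^sub>R f z) \<in> borel_measurable borel"
    using assms by (intro borel_measurable_continuous_on_indicator) (auto simp: borel_compact)
  then have "(\<lambda>z. indicator G z *\<^sub>R f z) \<in> borel_measurable V"
    using measurable_cong_sets[OF assms(2) refl] by blast
  then show ?thesis
    by (rule integrable_const_bound[rotated]) (use B in \<open>auto simp: indicator_def intro!: AE_I2[where P="\<lambda>z. norm (indicator G z *\<^sub>R f z) \<le> B"]\<close>)
qed

text \<open>The cut-offs of \<open>H\<close> to growing balls are measurable and converge to
  \<open>H\<close> pointwise. Since \<open>V\<close> is concentrated on a compact set, local
  integrability there is integrability.\<close>

lemma weak_mc_integrable:
  fixes V :: "((real^'S) \<times> (real^'S^'S)) measure"
  assumes V: "varifold Nbar m N V" and H: "weak_mc V H" and G: "compact (Gm Nbar m N)"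
  shows "integrable V H"
proof -
  have si: "set_integrable V K H" if "compact K" for K using H that by (simp add: weak_mc_def)
  have meas: "H \<in> borel_measurable V"
  proof (rule borel_measurable_LIMSEQ_metric)
    show "(\<lambda>z. indicator (cball 0 (real n)) z *\<^sub>R H z) \<in> borel_measurable V" for n
      using si[OF compact_cball] unfolding set_integrable_def by (rule borel_measurable_integrable)
    fix z :: "(real^'S) \<times> (real^'S^'S)"
    obtain n0 :: nat where n0: "norm z \<le> real n0" using real_arch_simple by blast
    have "indicator (cball 0 (real n)) z *\<^sub>R H z = H z" if "n \<ge> n0" for n
      using that n0 by (simp add: indicator_def)
    then have "\<forall>\<^sub>F n in sequentially. indicator (cball 0 (real n)) z *\<^sub>R H z = H z"
      unfolding eventually_sequentially by blast
    then show "(\<lambda>n. indicator (cball 0 (real n)) z *\<^sub>R H z) \<longlonglongrightarrow> H z" by (rule tendsto_eventually)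
  qed
  have "AE z in V. indicator (Gm Nbar m N) z *\<^sub>R H z = H z"
  proof -
    have "AE z in V. z \<in> Gm Nbar m N" using V by (simp add: varifold_def)
    then show ?thesis by eventually_elim simp
  qed
  then show ?thesis
    by (rule integrable_cong_AE_imp[OF si[OF G, unfolded set_integrable_def] meas])
qed

lemma divP_continuous:
  assumes "C1c X"
  shows "continuous_on UNIV (\<lambda>z. divP (snd z) X (fst z))"
proof -
  have C1: "Ck_on 1 X UNIV" using assms by (simp add: C1c_def)
  have "continuous_on UNIV (\<lambda>z. Defs.pderiv X j i (fst z))" for i j
    unfolding Defs.pderiv_def
    by (intro continuous_intros Ck_on_1_derivative_continuous[OF C1]) auto
  then show ?thesis unfolding divP_def by (intro continuous_intros) auto
qed

lemma C1c_continuous: "C1c X \<Longrightarrow> continuous_on UNIV X"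
  by (simp add: C1c_def Ck_on_1_imp_continuous_on del: One_nat_def)

lemma C1c_bounded:
  assumes "C1c X" obtains B where "B > 0" "\<And>x. norm (X x) \<le> B"
proof -
  have "bounded (X ` closure {x. X x \<noteq> 0})"
    using assms by (intro compact_imp_bounded compact_continuous_image continuous_on_subset[OF C1c_continuous])
      (auto simp: C1c_def)
  then obtain B where B: "B > 0" "\<And>x. x \<in> closure {x. X x \<noteq> 0} \<Longrightarrow> norm (X x) \<le> B"
    by (auto simp: bounded_pos)
  have "norm (X x) \<le> B" for x
  proof (cases "X x = 0")
    case False
    then show ?thesis using closure_subset[of "{x. X x \<noteq> 0}"] by (intro B(2)) auto
  qed (use B in simp)
  then show thesis using that B(1) by blast
qed

text \<open>Splitting the mean curvature in the first variation formula into \<open>HN\<close> and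
  the curvature term leaves minus the integral of HN . X, bounded by \<open>B\<close> times the
  integral of |HN|. The integrand on the left is continuous on \<open>Gm\<close> and free of
  \<open>H\<close>, so it passes to weak limits.\<close>

lemma first_variation_bound:
  fixes V :: "((real^'S) \<times> (real^'S^'S)) measure"
  assumes V: "varifold Nbar m N V" and H: "weak_mc V H" and G: "compact (Gm Nbar m N)"
    and curv: "continuous_on (Gm Nbar m N) (ambient_curvature Nbar)"
    and X: "C1c X" and B: "\<And>x. norm (X x) \<le> B"
  defines "h \<equiv> \<lambda>z. indicator (Gm Nbar m N) z *\<^sub>R HN Nbar H z"
  shows "integrable V h"
    and "\<bar>\<integral>z. indicator (Gm Nbar m N) z *\<^sub>R
            (divP (snd z) X (fst z) + ambient_curvature Nbar z \<bullet> X (fst z)) \<partial>V\<bar> \<le> B * (\<integral>z. norm (h z) \<partial>V)"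
proof -
  define G where "G = Gm Nbar m N"
  have fin: "finite_measure V" by (rule varifold_finite_measure[OF V G])
  have s: "sets V = sets borel" using V by (simp add: varifold_def)
  have AEG: "AE z in V. z \<in> G" using V by (simp add: varifold_def G_def)
  have G: "compact G" and curv: "continuous_on G (ambient_curvature Nbar)"
    using G curv by (simp_all add: G_def)
  note [measurable_cong] = s
  have Gb[measurable]: "G \<in> sets borel" using G by (simp add: borel_compact)
  have iH: "integrable V H" using weak_mc_integrable[OF V H] G unfolding G_def by blast
  note ic = integrable_continuous_on_compact[OF fin s G]
  have iGH: "integrable V (\<lambda>z. indicator G z *\<^sub>R H z)"
    using iH by (intro integrable_mult_indicator) auto
  have h: "h z = indicator G z *\<^sub>R H z - indicator G z *\<^sub>R ambient_curvature Nbar z" for z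
    unfolding h_def G_def HN_eq by (simp add: scaleR_diff_right)
  show ih: "integrable V h" unfolding h[abs_def] by (intro Bochner_Integration.integrable_diff iGH ic curv)
  have Xc: "continuous_on S (\<lambda>z. X (fst z))" for S :: "((real^'S) \<times> (real^'S^'S)) set"
    by (rule continuous_on_compose2[OF C1c_continuous[OF X]]) (auto intro: continuous_intros)
  have Xm[measurable]: "(\<lambda>z. X (fst z)) \<in> borel_measurable V"
    using borel_measurable_continuous_onI[OF Xc] measurable_cong_sets[OF s refl] by blast
  have dc: "continuous_on S (\<lambda>z. divP (snd z) X (fst z))" for S
    using divP_continuous[OF X] by (rule continuous_on_subset) simp
  have dm[measurable]: "(\<lambda>z. divP (snd z) X (fst z)) \<in> borel_measurable V"
    using borel_measurable_continuous_onI[OF dc] measurable_cong_sets[OF s refl] by blast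
  have Hm[measurable]: "H \<in> borel_measurable V" using iH by auto
  have id: "integrable V (\<lambda>z. indicator G z *\<^sub>R divP (snd z) X (fst z))" by (rule ic[OF dc])
  have icX: "integrable V (\<lambda>z. indicator G z *\<^sub>R (ambient_curvature Nbar z \<bullet> X (fst z)))"
    by (intro ic continuous_intros curv Xc)
  have nb: "norm (g z \<bullet> X (fst z)) \<le> norm (B * norm (g z))" for g :: "_ \<Rightarrow> real^'S" and z
  proof -
    have "norm (g z \<bullet> X (fst z)) \<le> norm (g z) * norm (X (fst z))" using Cauchy_Schwarz_ineq2 by simp
    also have "\<dots> \<le> norm (g z) * B" by (intro mult_left_mono B) simp
    also have "\<dots> \<le> norm (B * norm (g z))" by (simp add: mult.commute)
    finally show ?thesis .
  qed
  have ihX: "integrable V (\<lambda>z. h z \<bullet> X (fst z))"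
  proof (rule Bochner_Integration.integrable_bound)
    show "integrable V (\<lambda>z. B * norm (h z))" using ih by auto
    show "(\<lambda>z. h z \<bullet> X (fst z)) \<in> borel_measurable V"
      by (intro borel_measurable_inner borel_measurable_integrable[OF ih] Xm)
    show "AE z in V. norm (h z \<bullet> X (fst z)) \<le> norm (B * norm (h z))"
      by (rule AE_I2) (rule nb)
  qed
  have "(\<integral>z. indicator G z *\<^sub>R divP (snd z) X (fst z) \<partial>V) = (\<integral>z. divP (snd z) X (fst z) \<partial>V)"
  proof (rule integral_cong_AE)
    show "AE z in V. indicator G z *\<^sub>R divP (snd z) X (fst z) = divP (snd z) X (fst z)"
      using AEG by eventually_elim simp
  qed measurable
  also have "\<dots> = - (\<integral>z. H z \<bullet> X (fst z) \<partial>V)" using H X by (simp add: weak_mc_def)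
  also have "(\<integral>z. H z \<bullet> X (fst z) \<partial>V) =
      (\<integral>z. h z \<bullet> X (fst z) + indicator G z *\<^sub>R (ambient_curvature Nbar z \<bullet> X (fst z)) \<partial>V)"
  proof (rule integral_cong_AE)
    show "AE z in V. H z \<bullet> X (fst z) = h z \<bullet> X (fst z) + indicator G z *\<^sub>R (ambient_curvature Nbar z \<bullet> X (fst z))"
      using AEG by eventually_elim (simp add: h inner_diff_left)
    show "(\<lambda>z. h z \<bullet> X (fst z) + indicator G z *\<^sub>R (ambient_curvature Nbar z \<bullet> X (fst z))) \<in> borel_measurable V"
      using ihX icX by (intro borel_measurable_add borel_measurable_integrable)
  qed measurable
  also have "\<dots> = (\<integral>z. h z \<bullet> X (fst z) \<partial>V) + (\<integral>z. indicator G z *\<^sub>R (ambient_curvature Nbar z \<bullet> X (fst z)) \<partial>V)"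
    by (rule Bochner_Integration.integral_add[OF ihX icX])
  finally have "(\<integral>z. indicator G z *\<^sub>R (divP (snd z) X (fst z) + ambient_curvature Nbar z \<bullet> X (fst z)) \<partial>V) =
      - (\<integral>z. h z \<bullet> X (fst z) \<partial>V)"
    using Bochner_Integration.integral_add[OF id icX] by (simp add: distrib_left)
  moreover have "\<bar>\<integral>z. h z \<bullet> X (fst z) \<partial>V\<bar> \<le> B * (\<integral>z. norm (h z) \<partial>V)"
  proof -
    have "B \<ge> 0" using B[of 0] norm_ge_zero order_trans by blast
    then have nb': "norm (h z \<bullet> X (fst z)) \<le> B * norm (h z)" for z using nb[of h z] by simp
    have "\<bar>\<integral>z. h z \<bullet> X (fst z) \<partial>V\<bar> \<le> (\<integral>z. norm (h z \<bullet> X (fst z)) \<partial>V)"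
      using integral_norm_bound[of V "\<lambda>z. h z \<bullet> X (fst z)"] by simp
    also have "\<dots> \<le> (\<integral>z. B * norm (h z) \<partial>V)"
      by (rule integral_mono[OF _ _ nb']) (use ihX ih in auto)
    finally show ?thesis by simp
  qed
  ultimately show "\<bar>\<integral>z. indicator (Gm Nbar m N) z *\<^sub>R
            (divP (snd z) X (fst z) + ambient_curvature Nbar z \<bullet> X (fst z)) \<partial>V\<bar> \<le> B * (\<integral>z. norm (h z) \<partial>V)"
    unfolding G_def by simp
qed

text \<open>The linear lower bound c (|q| - \<delta>) for \<open>F\<close> is integrated over
  \<open>V\<close> at q = HN.\<close>

lemma integral_norm_HN_le:
  assumes V: "varifold Nbar m N V" and G: "compact (Gm Nbar m N)"
    and ih: "integrable V (\<lambda>z. indicator (Gm Nbar m N) z *\<^sub>R HN Nbar H z)"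
    and c: "c > 0" "\<delta> > 0" "\<And>z q. z \<in> Gm Nbar m N \<Longrightarrow> c * (norm q - \<delta>) \<le> F z q"
    and nn: "\<And>z q. z \<in> Gm Nbar m N \<Longrightarrow> 0 \<le> F z q"
    and r: "r \<ge> 0" "(\<integral>\<^sup>+ z. ennreal (F z (HN Nbar H z)) \<partial>V) \<le> ennreal r"
  shows "(\<integral>z. norm (indicator (Gm Nbar m N) z *\<^sub>R HN Nbar H z) \<partial>V) \<le> \<delta> * mass V + r / c"
proof -
  define G where "G = Gm Nbar m N"
  define h where "h z = indicator G z *\<^sub>R HN Nbar H z" for z
  interpret finite_measure V by (rule varifold_finite_measure[OF V G])
  have AEG: "AE z in V. z \<in> G" using V by (simp add: varifold_def G_def)
  have ih: "integrable V h" using ih by (simp add: h_def[abs_def] G_def)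
  \<comment> \<open>The linear bound may be negative, whereas the integral of \<open>F\<close> is a
    nonnegative extended one; the positive part links the two.\<close>
  define g where "g z = max 0 (c * (norm (h z) - \<delta>))" for z
  have ig0: "integrable V (\<lambda>z. c * (norm (h z) - \<delta>))" using ih by auto
  then have ig: "integrable V g" unfolding g_def by (intro integrable_max) auto
  have "ennreal (\<integral>z. g z \<partial>V) = (\<integral>\<^sup>+ z. ennreal (g z) \<partial>V)"
    by (rule nn_integral_eq_integral[OF ig, symmetric]) (simp add: g_def)
  also have "\<dots> \<le> (\<integral>\<^sup>+ z. ennreal (F z (HN Nbar H z)) \<partial>V)"
  proof (rule nn_integral_mono_AE)
    show "AE z in V. ennreal (g z) \<le> ennreal (F z (HN Nbar H z))"
      using AEG
    proof eventually_elim
      case (elim z)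
      then show ?case using c(3)[of z "HN Nbar H z"] nn[of z "HN Nbar H z"]
        by (intro ennreal_leI) (simp add: g_def h_def G_def)
    qed
  qed
  also have "\<dots> \<le> ennreal r" by (rule r)
  finally have "(\<integral>z. g z \<partial>V) \<le> r" using r(1) by simp
  moreover have "(\<integral>z. c * (norm (h z) - \<delta>) \<partial>V) \<le> (\<integral>z. g z \<partial>V)"
    by (intro integral_mono ig ig0) (simp add: g_def)
  moreover have "(\<integral>z. c * (norm (h z) - \<delta>) \<partial>V) = c * ((\<integral>z. norm (h z) \<partial>V) - \<delta> * mass V)"
    using ih by (simp add: mass_def mult.commute)
  ultimately have "c * ((\<integral>z. norm (h z) \<partial>V) - \<delta> * mass V) \<le> r" by linarith
  then have "(\<integral>z. norm (h z) \<partial>V) - \<delta> * mass V \<le> r / c" using c(1) by (simp add: field_simps)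
  then show ?thesis by (simp add: h_def G_def)
qed

text \<open>After division by the mass, the integrals of |HN| are at most \<delta> + 1/(c (k+1)).
  The first variation bound then forces the weak limit to satisfy the mean curvature formula with
  the curvature term alone in place of \<open>H\<close>.\<close>

lemma null_mean_curvature_limit:
  fixes Nbar N :: "(real^'S) set" and V :: "nat \<Rightarrow> ((real^'S) \<times> (real^'S^'S)) measure"
  assumes G: "compact (Gm Nbar m N)"
    and curv: "continuous_on (Gm Nbar m N) (ambient_curvature Nbar)"
    and F: "condF (Gm Nbar m N) F"
    and V: "\<And>k. varifold Nbar m N (V k)" and H: "\<And>k. weak_mc (V k) (H k)"
    and big: "\<And>k. ennreal (real (Suc k)) * (\<integral>\<^sup>+ z. ennreal (F z (HN Nbar (H k) z)) \<partial>V k) < ennreal (mass (V k))"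
  shows "\<exists>\<nu>. varifold Nbar m N \<nu> \<and> emeasure \<nu> (space \<nu>) \<noteq> 0 \<and>
               (\<exists>H. weak_mc \<nu> H \<and> (AE z in \<nu>. HN Nbar H z = 0))"
proof -
  define G where "G = Gm Nbar m N"
  have AEV: "AE z in V k. z \<in> G" for k using V[of k] by (simp add: varifold_def G_def)
  have sV: "sets (V k) = sets borel" for k using V[of k] by (simp add: varifold_def)
  have finV: "finite_measure (V k)" for k by (rule varifold_finite_measure[OF V G])
  have Gc: "compact G" and curv': "continuous_on G (ambient_curvature Nbar)"
    using G curv by (simp_all add: G_def)
  define M where "M k = mass (V k)" for k
  \<comment> \<open>Strictness in the assumption excludes mass zero, so normalising is
    possible.\<close>
  have M: "M k > 0" for k
  proof -
    have "0 < ennreal (M k)" unfolding M_def using big[of k] by (rule le_less_trans[OF zero_le])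
    then show ?thesis by simp
  qed
  \<comment> \<open>The integral is finite, since an infinite one times k+1 could not stay below the
    mass.\<close>
  have I: "(\<integral>\<^sup>+ z. ennreal (F z (HN Nbar (H k) z)) \<partial>V k) \<le> ennreal (M k / real (Suc k))" for k
  proof (cases "\<integral>\<^sup>+ z. ennreal (F z (HN Nbar (H k) z)) \<partial>V k")
    case (real r)
    then have "ennreal (real (Suc k) * r) < ennreal (M k)"
      using big[of k] by (simp add: M_def ennreal_mult del: of_nat_Suc)
    then have "real (Suc k) * r < M k" using M[of k] by (simp add: ennreal_less_iff real(1))
    then have "r \<le> M k / real (Suc k)" by (simp add: field_simps)
    then show ?thesis unfolding real(2) by (rule ennreal_leI)
  next
    case top
    then show ?thesis using big[of k] by (simp add: ennreal_mult_top)
  qed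
  define \<mu> where "\<mu> k = density (V k) (\<lambda>_. ennreal (1 / M k))" for k
  have \<mu>_int: "(\<integral>z. f z \<partial>\<mu> k) = (\<integral>z. f z \<partial>V k) / M k"
    if "f \<in> borel_measurable borel" for f :: "_ \<Rightarrow> real" and k
  proof -
    have "f \<in> borel_measurable (V k)" using that measurable_cong_sets[OF sV refl] by blast
    then show ?thesis unfolding \<mu>_def using M[of k] by (subst integral_density) auto
  qed
  have prob: "prob_space (\<mu> k)" for k
  proof
    interpret finite_measure "V k" by (rule finV)
    have "emeasure (\<mu> k) (space (\<mu> k)) = ennreal (1 / M k) * emeasure (V k) (space (V k))"
      unfolding \<mu>_def by (simp add: emeasure_density)
    also have "\<dots> = ennreal (1 / M k) * ennreal (M k)" by (simp add: emeasure_eq_measure M_def mass_def)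
    also have "\<dots> = 1" using M[of k] by (simp flip: ennreal_mult)
    finally show "emeasure (\<mu> k) (space (\<mu> k)) = 1" .
  qed
  have s\<mu>: "sets (\<mu> k) = sets borel" for k by (simp add: \<mu>_def sV)
  have AE\<mu>: "AE z in \<mu> k. z \<in> G" for k
    unfolding \<mu>_def using AEV[of k] by (subst AE_density) auto
  obtain r \<nu> where r: "strict_mono (r :: nat \<Rightarrow> nat)" and \<nu>: "prob_space \<nu>" and s\<nu>: "sets \<nu> = sets borel"
    and AE\<nu>: "AE z in \<nu>. z \<in> G"
    and conv: "\<And>f::_ \<Rightarrow> real. continuous_on G f \<Longrightarrow>
       (\<lambda>n. \<integral>z. indicator G z *\<^sub>R f z \<partial>\<mu> (r n)) \<longlonglongrightarrow> (\<integral>z. indicator G z *\<^sub>R f z \<partial>\<nu>)"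
    by (rule compact_prob_measures_subseq[where \<mu> = \<mu>, OF Gc prob s\<mu> AE\<mu>]) blast
  interpret \<nu>: prob_space \<nu> by fact
  have Gb: "G \<in> sets borel" using Gc by (simp add: borel_compact)
  \<comment> \<open>The mean curvature proposed for the limit is the curvature term itself, so that
    subtracting it in \<open>HN\<close> leaves 0 on \<open>G\<close>.\<close>
  define K where "K z = indicator G z *\<^sub>R ambient_curvature Nbar z" for z
  have iK: "integrable \<nu> K" unfolding K_def
    by (rule integrable_continuous_on_compact[OF \<nu>.finite_measure_axioms s\<nu> Gc curv'])
  have weak: "(\<integral>z. divP (snd z) X (fst z) \<partial>\<nu>) = - (\<integral>z. K z \<bullet> X (fst z) \<partial>\<nu>)" if X: "C1c X" for X
  proof -
    obtain B where B: "B > 0" "\<And>x. norm (X x) \<le> B" by (rule C1c_bounded[OF X]) blast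
    have Xc: "continuous_on S (\<lambda>z. X (fst z))" for S :: "((real^'S) \<times> (real^'S^'S)) set"
      by (rule continuous_on_compose2[OF C1c_continuous[OF X]]) (auto intro: continuous_intros)
    have dc: "continuous_on S (\<lambda>z. divP (snd z) X (fst z))" for S
      using divP_continuous[OF X] by (rule continuous_on_subset) simp
    have cX: "continuous_on G (\<lambda>z. ambient_curvature Nbar z \<bullet> X (fst z))"
      by (intro continuous_intros curv' Xc)
    define f where "f z = divP (snd z) X (fst z) + ambient_curvature Nbar z \<bullet> X (fst z)" for z
    have fc: "continuous_on G f" unfolding f_def by (intro continuous_intros dc cX)
    have fm: "(\<lambda>z. indicator G z *\<^sub>R f z) \<in> borel_measurable borel"
      by (rule borel_measurable_continuous_on_indicator[OF Gb fc])
    define L where "L = (\<integral>z. indicator G z *\<^sub>R f z \<partial>\<nu>)"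
    \<comment> \<open>The constant \<open>c\<close> depends on \<delta>, so the index goes to
      infinity with \<delta> fixed, and \<delta> becomes arbitrarily small only afterwards.\<close>
    have "\<bar>L\<bar> \<le> B * \<delta>" if \<delta>: "\<delta> > 0" for \<delta>
    proof -
      obtain c where c: "c > 0" "\<And>z q. z \<in> G \<Longrightarrow> c * (norm q - \<delta>) \<le> F z q"
        using condF_lower_bound[OF F G \<delta>] unfolding G_def by blast
      have nn: "\<And>z q. z \<in> G \<Longrightarrow> 0 \<le> F z q" using F by (auto simp: condF_def G_def)
      have bd: "\<bar>\<integral>z. indicator G z *\<^sub>R f z \<partial>\<mu> k\<bar> \<le> B * (\<delta> + inverse (real (Suc k)) / c)" for k
      proof -
        note fv = first_variation_bound[OF V[of k] H[of k] G curv X B(2)]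
        have "\<bar>\<integral>z. indicator G z *\<^sub>R f z \<partial>V k\<bar> \<le> B * (\<integral>z. norm (indicator G z *\<^sub>R HN Nbar (H k) z) \<partial>V k)"
          using fv(2) unfolding f_def G_def .
        also have "\<dots> \<le> B * (\<delta> * M k + M k / real (Suc k) / c)"
          using integral_norm_HN_le[OF V G fv(1) c(1) \<delta> c(2)[unfolded G_def] nn[unfolded G_def] _ I] B(1) M[of k]
          by (intro mult_left_mono) (simp_all add: G_def M_def)
        also have "\<dots> = B * (\<delta> + inverse (real (Suc k)) / c) * M k"
          using c(1) by (simp add: field_simps)
        finally show ?thesis
          unfolding \<mu>_int[OF fm] using M[of k] by (simp add: pos_divide_le_eq)
      qed
      have "(\<lambda>n. \<bar>\<integral>z. indicator G z *\<^sub>R f z \<partial>\<mu> (r n)\<bar>) \<longlonglongrightarrow> \<bar>L\<bar>"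
        unfolding L_def by (intro tendsto_rabs conv fc)
      moreover have "(\<lambda>n. B * (\<delta> + inverse (real (Suc (r n))) / c)) \<longlonglongrightarrow> B * (\<delta> + 0 / c)"
        using LIMSEQ_subseq_LIMSEQ[OF LIMSEQ_inverse_real_of_nat r] c(1)
        by (intro tendsto_intros) (auto simp: comp_def)
      ultimately have "\<bar>L\<bar> \<le> B * (\<delta> + 0 / c)"
        by (rule LIMSEQ_le) (use bd in blast)
      then show ?thesis by simp
    qed
    then have "\<bar>L\<bar> \<le> 0 + e" if "e > 0" for e using that B(1) by (metis add_0 divide_pos_pos nonzero_mult_div_cancel_left less_irrefl times_divide_eq_right)
    then have "\<bar>L\<bar> \<le> 0" by (rule field_le_epsilon)
    then have L0: "L = 0" by simp
    note ic = integrable_continuous_on_compact[OF \<nu>.finite_measure_axioms s\<nu> Gc]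
    have "L = (\<integral>z. indicator G z *\<^sub>R divP (snd z) X (fst z) \<partial>\<nu>) +
        (\<integral>z. indicator G z *\<^sub>R (ambient_curvature Nbar z \<bullet> X (fst z)) \<partial>\<nu>)"
      unfolding L_def f_def using Bochner_Integration.integral_add[OF ic[OF dc] ic[OF cX]] by (simp add: distrib_left)
    moreover have "(\<integral>z. indicator G z *\<^sub>R divP (snd z) X (fst z) \<partial>\<nu>) = (\<integral>z. divP (snd z) X (fst z) \<partial>\<nu>)"
    proof (rule integral_cong_AE)
      show "AE z in \<nu>. indicator G z *\<^sub>R divP (snd z) X (fst z) = divP (snd z) X (fst z)"
        using AE\<nu> by eventually_elim simp
      show "(\<lambda>z. divP (snd z) X (fst z)) \<in> borel_measurable \<nu>"
        using borel_measurable_continuous_onI[OF dc] measurable_cong_sets[OF s\<nu> refl] by blast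
    qed (rule borel_measurable_integrable[OF ic[OF dc]])
    moreover have "(\<integral>z. indicator G z *\<^sub>R (ambient_curvature Nbar z \<bullet> X (fst z)) \<partial>\<nu>) = (\<integral>z. K z \<bullet> X (fst z) \<partial>\<nu>)"
      by (simp add: K_def)
    ultimately show ?thesis using L0 by linarith
  qed
  show ?thesis
  proof (intro exI conjI)
    show "varifold Nbar m N \<nu>"
      using AE\<nu> s\<nu> \<nu>.emeasure_finite by (simp add: varifold_def G_def flip: less_top)
    show "emeasure \<nu> (space \<nu>) \<noteq> 0" by (simp add: \<nu>.emeasure_space_1)
    have "set_integrable \<nu> C K" if "compact C" for C
      unfolding set_integrable_def using that iK
      by (intro integrable_mult_indicator) (auto simp: s\<nu> borel_compact)
    then show "weak_mc \<nu> K" unfolding weak_mc_def using weak by blast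
    show "AE z in \<nu>. HN Nbar K z = 0" using AE\<nu>
      by eventually_elim (simp add: HN_eq K_def)
  qed
qed

section \<open>The equivalence of the three conditions\<close>

text \<open>A concrete admissible integrand, with \<phi>(t) = t, is what turns the universal
  statement (iii) into the existential statement (ii).\<close>

lemma condF_norm_square: "condF G (\<lambda>z q. (norm q)\<^sup>2)"
  unfolding condF_def
proof (intro conjI)
  show "continuous_on (G \<times> UNIV) (\<lambda>(z, q). (norm q)\<^sup>2)"
    by (auto simp: case_prod_beta intro!: continuous_intros)
  show "\<forall>z\<in>G. convex_on UNIV (\<lambda>q::real^'a. (norm q)\<^sup>2)"
  proof (intro ballI convex_onI)
    fix t :: real and x y :: "real^'a" assume t: "0 < t" "t < 1"
    have "norm ((1 - t) *\<^sub>R x + t *\<^sub>R y) \<le> (1 - t) * norm x + t * norm y"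
      using norm_triangle_ineq[of "(1 - t) *\<^sub>R x" "t *\<^sub>R y"] t by simp
    then have "(norm ((1 - t) *\<^sub>R x + t *\<^sub>R y))\<^sup>2 \<le> ((1 - t) *\<^sub>R norm x + t *\<^sub>R norm y)\<^sup>2"
      by (intro power_mono) auto
    also have "\<dots> \<le> (1 - t) * (norm x)\<^sup>2 + t * (norm y)\<^sup>2"
      using t by (intro convex_onD[OF convex_power2]) auto
    finally show "(norm ((1 - t) *\<^sub>R x + t *\<^sub>R y))\<^sup>2 \<le> (1 - t) * (norm x)\<^sup>2 + t * (norm y)\<^sup>2" .
  qed auto
  show "\<exists>\<phi>. continuous_on (G \<times> {0..}) (\<lambda>(z, t). \<phi> z t) \<and>
          (\<forall>z\<in>G. \<forall>t\<ge>0. \<phi> z t \<ge> 0) \<and>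
          (\<forall>z\<in>G. mono_on {0..} (\<phi> z)) \<and>
          (\<forall>z0\<in>G. \<exists>U. open U \<and> z0 \<in> U \<and>
              (\<forall>M. \<exists>T. \<forall>t\<ge>T. \<forall>z\<in>U \<inter> G. \<phi> z t \<ge> M)) \<and>
          (\<forall>z\<in>G. \<forall>q. \<phi> z (norm q) * norm q \<le> (norm (q::real^'a))\<^sup>2)"
    by (intro exI[of _ "\<lambda>z t. t"])
      (auto simp: case_prod_beta power2_eq_square mono_on_def intro!: continuous_intros exI[of _ UNIV])
qed auto

theorem theorem4p6:
  fixes Nbar N :: "(real^'S) set" and n m :: nat
  assumes "submanifold n Nbar" and "compact N" and "N \<subseteq> Nbar"
    and "1 \<le> m" and "m \<le> n - 1"
  shows "((\<not> (\<exists>V. varifold Nbar m N V \<and> emeasure V (space V) \<noteq> 0 \<and>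
               (\<exists>H. weak_mc V H \<and> (AE z in V. HN Nbar H z = 0))))
         \<longleftrightarrow>
         (\<exists>(\<Phi>::real \<Rightarrow> real) F. mono_on {0..} \<Phi> \<and> (\<forall>t\<ge>0. \<Phi> t \<ge> 0) \<and> \<Phi> 0 = 0 \<and>
            condF (Gm Nbar m N) F \<and>
            (\<forall>V H. varifold Nbar m N V \<and> weak_mc V H \<longrightarrow>
               (\<integral>\<^sup>+ z. ennreal (F z (HN Nbar H z)) \<partial>V) < \<infinity> \<longrightarrow>
               mass V \<le> \<Phi> (enn2real (\<integral>\<^sup>+ z. ennreal (F z (HN Nbar H z)) \<partial>V)))))
       \<and> ((\<exists>(\<Phi>::real \<Rightarrow> real) F. mono_on {0..} \<Phi> \<and> (\<forall>t\<ge>0. \<Phi> t \<ge> 0) \<and> \<Phi> 0 = 0 \<and>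
            condF (Gm Nbar m N) F \<and>
            (\<forall>V H. varifold Nbar m N V \<and> weak_mc V H \<longrightarrow>
               (\<integral>\<^sup>+ z. ennreal (F z (HN Nbar H z)) \<partial>V) < \<infinity> \<longrightarrow>
               mass V \<le> \<Phi> (enn2real (\<integral>\<^sup>+ z. ennreal (F z (HN Nbar H z)) \<partial>V))))
         \<longleftrightarrow>
         (\<forall>F. condF (Gm Nbar m N) F \<longrightarrow>
            (\<exists>C::real. C > 0 \<and>
               (\<forall>V H. varifold Nbar m N V \<and> weak_mc V H \<longrightarrow>
                  ennreal (mass V) \<le> ennreal C * (\<integral>\<^sup>+ z. ennreal (F z (HN Nbar H z)) \<partial>V)))))"
    (is "(?i \<longleftrightarrow> ?ii) \<and> (?ii \<longleftrightarrow> ?iii)")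
proof -
  have G: "compact (Gm Nbar m N)" by (rule compact_Gm[OF assms(1,3,2)])
  have curv: "continuous_on (Gm Nbar m N) (ambient_curvature Nbar)"
    by (rule continuous_on_ambient_curvature[OF assms(1,3)])
  have "?iii" if i: ?i
  proof (intro allI impI)
    fix F assume F: "condF (Gm Nbar m N) F"
    show "\<exists>C::real. C > 0 \<and> (\<forall>V H. varifold Nbar m N V \<and> weak_mc V H \<longrightarrow>
                  ennreal (mass V) \<le> ennreal C * (\<integral>\<^sup>+ z. ennreal (F z (HN Nbar H z)) \<partial>V))"
    proof (rule ccontr)
      assume no: "\<not> ?thesis"
      \<comment> \<open>If no positive constant works, then in particular k+1 fails for every
        k.\<close>
      have "\<exists>V H. varifold Nbar m N V \<and> weak_mc V H \<and>
         ennreal (real (Suc k)) * (\<integral>\<^sup>+ z. ennreal (F z (HN Nbar H z)) \<partial>V) < ennreal (mass V)" for k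
      proof (rule ccontr)
        assume no': "\<not> ?thesis"
        have "real (Suc k) > 0" by simp
        moreover have "\<forall>V H. varifold Nbar m N V \<and> weak_mc V H \<longrightarrow>
            ennreal (mass V) \<le> ennreal (real (Suc k)) * (\<integral>\<^sup>+ z. ennreal (F z (HN Nbar H z)) \<partial>V)"
          using no' not_less by blast
        ultimately show False using no by blast
      qed
      then obtain V H where VH: "\<And>k. varifold Nbar m N (V k)" "\<And>k. weak_mc (V k) (H k)"
        "\<And>k. ennreal (real (Suc k)) * (\<integral>\<^sup>+ z. ennreal (F z (HN Nbar (H k) z)) \<partial>V k) < ennreal (mass (V k))"
        by metis
      show False using null_mean_curvature_limit[OF G curv F VH] i by blast
    qed
  qed
  \<comment> \<open>The statement for |q|^2 gives a linear \<Phi>, with slope the constant of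
    (iii).\<close>
  moreover have "?ii" if iii: ?iii
  proof -
    obtain C :: real where C: "C > 0" "\<And>V H. varifold Nbar m N V \<and> weak_mc V H \<Longrightarrow>
        ennreal (mass V) \<le> ennreal C * (\<integral>\<^sup>+ z. ennreal ((norm (HN Nbar H z))\<^sup>2) \<partial>V)"
      using iii condF_norm_square by blast
    show ?ii
    proof (intro exI conjI allI impI)
      show "mono_on {0..} ((*) C)" using C(1) by (auto simp: mono_on_def)
      show "C * t \<ge> 0" if "t \<ge> 0" for t using C(1) that by simp
      show "C * 0 = 0" by simp
      show "condF (Gm Nbar m N) (\<lambda>z q. (norm q)\<^sup>2)" by (rule condF_norm_square)
      fix V H assume VH: "varifold Nbar m N V \<and> weak_mc V H"
        and fin: "(\<integral>\<^sup>+ z. ennreal ((norm (HN Nbar H z))\<^sup>2) \<partial>V) < \<infinity>"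
      have "ennreal (mass V) \<le> ennreal (C * enn2real (\<integral>\<^sup>+ z. ennreal ((norm (HN Nbar H z))\<^sup>2) \<partial>V))"
        using C(2)[OF VH] C(1) fin by (simp add: ennreal_mult)
      then show "mass V \<le> C * enn2real (\<integral>\<^sup>+ z. ennreal ((norm (HN Nbar H z))\<^sup>2) \<partial>V)"
        using C(1) by (simp add: ennreal_le_iff)
    qed
  qed
  moreover have "?i" if ii: ?ii
  proof
    assume "\<exists>V. varifold Nbar m N V \<and> emeasure V (space V) \<noteq> 0 \<and>
               (\<exists>H. weak_mc V H \<and> (AE z in V. HN Nbar H z = 0))"
    then obtain V H where V: "varifold Nbar m N V" "emeasure V (space V) \<noteq> 0" "weak_mc V H"
      "AE z in V. HN Nbar H z = 0" by blast
    obtain \<Phi> :: "real \<Rightarrow> real" and F where \<Phi>: "\<Phi> 0 = 0" "condF (Gm Nbar m N) F"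
      "(\<integral>\<^sup>+ z. ennreal (F z (HN Nbar H z)) \<partial>V) < \<infinity> \<Longrightarrow>
               mass V \<le> \<Phi> (enn2real (\<integral>\<^sup>+ z. ennreal (F z (HN Nbar H z)) \<partial>V))"
      using ii V(1,3) by blast
    \<comment> \<open>\<open>mass\<close> is a real number and would be 0 also for an infinite
      measure; finiteness lets zero mass contradict that \<open>V\<close> is non-zero.\<close>
    interpret finite_measure V by (rule varifold_finite_measure[OF V(1) G])
    have "AE z in V. z \<in> Gm Nbar m N" using V(1) by (simp add: varifold_def)
    \<comment> \<open>Null mean curvature makes the integral of \<open>F\<close> vanish, so the mass
      is at most \<Phi>(0) = 0.\<close>
    with V(4) have "AE z in V. ennreal (F z (HN Nbar H z)) = 0"
      by eventually_elim (use \<Phi>(2) in \<open>simp add: condF_def\<close>)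
    then have "(\<integral>\<^sup>+ z. ennreal (F z (HN Nbar H z)) \<partial>V) = (\<integral>\<^sup>+ z. 0 \<partial>V)"
      by (rule nn_integral_cong_AE)
    then have "mass V \<le> 0" using \<Phi>(1,3) by simp
    then have "emeasure V (space V) = 0" by (simp add: mass_def emeasure_eq_measure measure_le_0_iff)
    with V(2) show False by simp
  qed
  ultimately show ?thesis by blast
qed

end
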